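(* Let $a,b\in(0,1)$ be such that (i) $f_1$ is concave on $[0,a]$ and convex on $[a,1]$; (ii) $f_2$ is convex on $[0,b]$ and concave on $[b,1]$; (iii) if $b\le a$, then $f_i<g_i$ on $[b,a]$ for $i=1,2$. For every $r\in[b,1]$, a point $\ell_r\in[0,a]$ with $\ell_r<r$ satisfies $$U_1(x,r)\le U_1(\ell_r,r)\quad\forall x\in[0,r)$$ if and only if $$\sup_{\tau_1\in\mathcal T}M_1^x(\tau_1,D_{[r,1]})=M_1^x(D_{[0,\ell_r]},D_{[r,1]})\quad\forall x\in[0,1].$$ Similarly, for every $\ell\in[0,a]$, a point $r_\ell\in[b,1]$ with $\ell<r_\ell$ satisfies $$U_2(\ell,y)\le U_2(\ell,r_\ell)\quad\forall y\in(\ell,1]$$ if and only if $$\sup_{\tau_2\in\mathcal T}M_2^x(D_{[0,\ell]},\tau_2)=M_2^x(D_{[0,\ell]},D_{[r_\ell,1]})\quad\forall x\in[0,1].$$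
   Context: Process. Let $W=(W_t)_{t\ge0}$ be a one-dimensional standard Brownian motion on a filtered probability space with universally completed filtration $\mathbb F=(\mathcal F_t)_{t\ge0}$. Let $E=(0,1)$, $\zeta=\inf\{t\ge0: W_t\notin E\}$, and let $X_t=W_t$ for $0\le t<\zeta$ and $X_t=\Delta$ for $t\ge\zeta$ (including $t=\infty$), where $\Delta$ is a cemetery state; $E_\Delta=E\cup\{\Delta\}$. $\mathbb P^x,\mathbb E^x$ denote probability and expectation when the process starts at $x$ (for $x\in\{0,1\}$, $\zeta=0$ and the process is at $\Delta$ from time $0$). Every function $\phi$ is extended by $\phi(\Delta)=0$. $\mathcal T$ is the set of $\mathbb F$-stopping times with values in $[0,\infty]$. For a measurable set $A$, $D_A=\inf\{t\ge0: X_t\in A\}$ with $\inf\emptyset=\zeta$, and for a bounded measurable $\phi$, $\phi_A(x)=\mathbb E^x[\phi(X_{D_A})]$. Rewards. For $i=1,2$, $f_i,g_i,h_i$ are bounded continuous real functions on $[0,1]$ with $f_i\le h_i\le g_i$, vanishing at $0$ and $1$ (and at $\Delta$). Game. Writing $-i$ for the player other than $i$, for $\tau_1,\tau_2\in\mathcal T$, $$M_i^x(\tau_1,\tau_2)=\mathbb E^x\big[f_i(X_{\tau_i})1_{\{\tau_i<\tau_{-i}\}}+g_i(X_{\tau_{-i}})1_{\{\tau_{-i}<\tau_i\}}+h_i(X_{\tau_i})1_{\{\tau_i=\tau_{-i}\}}\big].$$ Utilities. For $(x,y)\in[0,1]^2$ with $x<y$, $$U_1(x,y)=\frac{f_1(x)-g_{1,[y,1]}(x)}{y-x},\qquad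 U_2(x,y)=\frac{f_2(y)-g_{2,[0,x]}(y)}{y-x},$$ and $U_1(x,y)=U_2(x,y)=-\infty$ if $x\ge y$. Here $g_{i,A}$ is $\phi_A$ with $\phi=g_i$; explicitly, for $x<y$, $g_{1,[y,1]}(x)=g_1(y)\frac{x}{y}$ and $g_{2,[0,x]}(y)=g_2(x)\frac{1-y}{1-x}$. *)

theory Defs
  imports "HOL-Probability.Probability"
begin

text \<open>
  Brownian motion as a Markov family: \<open>P x\<close> is the law under which \<open>W\<close> starts at \<open>x\<close>, all
  laws living on the same \<open>\<sigma>\<close>-algebra \<open>sets M\<close>.  \<open>G\<close> is the filtration before completion; it
  need not be the one generated by \<open>W\<close>.  Time runs through \<open>[0,\<infinity>]\<close>, encoded as \<open>ennreal\<close>,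
  for filtrations and random times, while \<open>W t\<close> is only meaningful for real \<open>t \<ge> 0\<close>.
\<close>

locale brownian_family = filtration "space M" G
  for M :: "'w measure" and G :: "ennreal \<Rightarrow> 'w measure" +
  fixes P :: "real \<Rightarrow> 'w measure" and W :: "real \<Rightarrow> 'w \<Rightarrow> real"
  assumes sets_G: "sets (G t) \<subseteq> sets M"
    and kernel: "P \<in> borel \<rightarrow>\<^sub>M prob_algebra M"
    and adapted: "0 \<le> t \<Longrightarrow> W t \<in> borel_measurable (G (ennreal t))"
    and continuous_paths: "\<omega> \<in> space M \<Longrightarrow> continuous_on {0..} (\<lambda>t. W t \<omega>)"
    and start: "AE \<omega> in P x. W 0 \<omega> = x"
    and normal_increments: "0 \<le> s \<Longrightarrow> s < t \<Longrightarrow>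
      distributed (P x) lborel (\<lambda>\<omega>. W t \<omega> - W s \<omega>) (normal_density 0 (sqrt (t - s)))"
    and indep_increments: "0 \<le> s \<Longrightarrow> s < t \<Longrightarrow>
      prob_space.indep_set (P x) (sets (G (ennreal s)))
        {(\<lambda>\<omega>. W t \<omega> - W s \<omega>) -` B \<inter> space M | B. B \<in> sets borel}"

text \<open>
  \<open>\<mu> \<bind> P\<close> is the law of the family with initial distribution \<open>\<mu>\<close>; the null sets of its
  completion are all subsets of its null sets.  Intersecting over all \<open>\<mu>\<close> gives the universal
  completion.
\<close>

definition universal_completion ::
  "'w measure \<Rightarrow> (real \<Rightarrow> 'w measure) \<Rightarrow> (ennreal \<Rightarrow> 'w measure) \<Rightarrow> ennreal \<Rightarrow> 'w measure" where
  "universal_completion M P G t = sigma (space M)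
     (\<Inter>\<mu>\<in>{\<mu> :: real measure. prob_space \<mu> \<and> sets \<mu> = sets borel}.
        sigma_sets (space M) (sets (G t) \<union> null_sets (completion (\<mu> \<bind> P))))"

definition stopping_times ::
  "'w measure \<Rightarrow> (real \<Rightarrow> 'w measure) \<Rightarrow> (ennreal \<Rightarrow> 'w measure) \<Rightarrow> ('w \<Rightarrow> ennreal) set" where
  "stopping_times M P G = {\<tau>. stopping_time (universal_completion M P G) \<tau>}"

definition exit_time :: "(real \<Rightarrow> 'w \<Rightarrow> real) \<Rightarrow> 'w \<Rightarrow> ennreal" where
  "exit_time W \<omega> = Inf {ennreal t | t. 0 \<le> t \<and> W t \<omega> \<notin> {0<..<1}}"

text \<open>The cemetery state is \<open>None\<close>; \<open>t < exit_time W \<omega>\<close> excludes \<open>t = \<infinity>\<close>.\<close>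

definition killed :: "(real \<Rightarrow> 'w \<Rightarrow> real) \<Rightarrow> ennreal \<Rightarrow> 'w \<Rightarrow> real option" where
  "killed W t \<omega> = (if t < exit_time W \<omega> then Some (W (enn2real t) \<omega>) else None)"

definition extend :: "(real \<Rightarrow> real) \<Rightarrow> real option \<Rightarrow> real" where
  "extend \<phi> z = (case z of None \<Rightarrow> 0 | Some x \<Rightarrow> \<phi> x)"

definition hitting_time :: "(real \<Rightarrow> 'w \<Rightarrow> real) \<Rightarrow> real set \<Rightarrow> 'w \<Rightarrow> ennreal" where
  "hitting_time W A \<omega> =
     (if \<exists>t. killed W t \<omega> \<in> Some ` A then Inf {t. killed W t \<omega> \<in> Some ` A}
      else exit_time W \<omega>)"

text \<open>
  Random variables determined by stopping times of the completed filtration are only measurable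
  for the completion of \<open>P x\<close>, so expectations are taken there.
\<close>

definition hitting_mean ::
  "(real \<Rightarrow> 'w measure) \<Rightarrow> (real \<Rightarrow> 'w \<Rightarrow> real) \<Rightarrow> (real \<Rightarrow> real) \<Rightarrow> real set \<Rightarrow> real \<Rightarrow> real" where
  "hitting_mean P W \<phi> A x =
     (\<integral>\<omega>. extend \<phi> (killed W (hitting_time W A \<omega>) \<omega>) \<partial>completion (P x))"

text \<open>The reward functions are indexed by the players \<open>1\<close> and \<open>2\<close>.\<close>

definition game_payoff ::
  "(real \<Rightarrow> 'w measure) \<Rightarrow> (real \<Rightarrow> 'w \<Rightarrow> real) \<Rightarrow>
   (nat \<Rightarrow> real \<Rightarrow> real) \<Rightarrow> (nat \<Rightarrow> real \<Rightarrow> real) \<Rightarrow> (nat \<Rightarrow> real \<Rightarrow> real) \<Rightarrow>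
   nat \<Rightarrow> real \<Rightarrow> ('w \<Rightarrow> ennreal) \<Rightarrow> ('w \<Rightarrow> ennreal) \<Rightarrow> real" where
  "game_payoff P W f g h i x \<tau>\<^sub>1 \<tau>\<^sub>2 =
     (let own = (if i = 1 then \<tau>\<^sub>1 else \<tau>\<^sub>2); other = (if i = 1 then \<tau>\<^sub>2 else \<tau>\<^sub>1) in
      \<integral>\<omega>. extend (f i) (killed W (own \<omega>) \<omega>) * indicator {\<omega>. own \<omega> < other \<omega>} \<omega>
         + extend (g i) (killed W (other \<omega>) \<omega>) * indicator {\<omega>. other \<omega> < own \<omega>} \<omega>
         + extend (h i) (killed W (own \<omega>) \<omega>) * indicator {\<omega>. own \<omega> = other \<omega>} \<omega>
      \<partial>completion (P x))"

definition utility1 ::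
  "(real \<Rightarrow> 'w measure) \<Rightarrow> (real \<Rightarrow> 'w \<Rightarrow> real) \<Rightarrow>
   (nat \<Rightarrow> real \<Rightarrow> real) \<Rightarrow> (nat \<Rightarrow> real \<Rightarrow> real) \<Rightarrow> real \<Rightarrow> real \<Rightarrow> ereal" where
  "utility1 P W f g x y =
     (if x < y then ereal ((f 1 x - hitting_mean P W (g 1) {y..1} x) / (y - x)) else -\<infinity>)"

definition utility2 ::
  "(real \<Rightarrow> 'w measure) \<Rightarrow> (real \<Rightarrow> 'w \<Rightarrow> real) \<Rightarrow>
   (nat \<Rightarrow> real \<Rightarrow> real) \<Rightarrow> (nat \<Rightarrow> real \<Rightarrow> real) \<Rightarrow> real \<Rightarrow> real \<Rightarrow> ereal" where
  "utility2 P W f g x y =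
     (if x < y then ereal ((f 2 y - hitting_mean P W (g 2) {0..x} y) / (y - x)) else -\<infinity>)"

end

theory Submission
  imports Defs
begin

text \<open>
  By optional stopping, a Brownian motion stopped before it leaves \<open>[0, 1]\<close> keeps its mean, so the
  expectation of an affine function of the stopped position is its value at the starting point.
  Hence \<open>D\<close> of \<open>[0, l]\<close> against \<open>D\<close> of \<open>[r, 1]\<close> pays, on \<open>[l, r]\<close>, the chord through \<open>(l, f l)\<close> and
  \<open>(r, g r)\<close>, and any affine function dominating \<open>f\<close> on \<open>[0, r]\<close> and \<open>g r\<close> at \<open>r\<close> bounds every
  other payoff.  Maximality of the utility at \<open>l\<close> says exactly that \<open>f\<close> lies below that chord on
  \<open>[0, r)\<close>.  The second player is the first one for the reflected process \<open>1 - W\<close>.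
\<close>

section \<open>Exit times of continuous paths\<close>

text \<open>Among lines through \<open>(r, g r)\<close>, the one with parameter \<open>c\<close> is
  \<open>g r * y / r + c * (r - y)\<close>, where \<open>g r * y / r\<close> is the hitting mean. A
  utility at \<open>y\<close> is thus at most \<open>c\<close> iff \<open>f y\<close> lies below
  that line, and a maximal utility belongs to the lowest such line that still dominates
  \<open>f\<close>, touching it at \<open>l\<close>. Left of \<open>l\<close> the threshold strategy
  stops at once and is worth \<open>f x\<close>, which may lie strictly below the chord, so the
  chord no longer gives a sharp bound. Concavity supplies a supporting line at \<open>x\<close>
  instead, and comparing slopes at \<open>l\<close> shows that it stays above the chord to the right
  of \<open>l\<close>. The probabilistic obstacle is that increments of \<open>W\<close> are
  independent of the raw filtration \<open>G\<close> only, while strategies are stopping times of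
  its universal completion, and stopped positions are measurable only for the completion of each
  law. Optional stopping is therefore derived from independent increments for times whose events
  agree almost surely with raw ones, and every integral is taken under
  \<open>completion (P x)\<close>.\<close>

definition first_exit :: "real \<Rightarrow> real \<Rightarrow> (real \<Rightarrow> real) \<Rightarrow> ennreal" where
  "first_exit c d w = Inf {ennreal t | t. 0 \<le> t \<and> w t \<notin> {c<..<d}}"

lemma exit_time_eq_first_exit: "exit_time W \<omega> = first_exit 0 1 (\<lambda>t. W t \<omega>)"
  by (simp add: exit_time_def first_exit_def)

lemma first_exit_le: "0 \<le> t \<Longrightarrow> w t \<notin> {c<..<d} \<Longrightarrow> first_exit c d w \<le> ennreal t"
  unfolding first_exit_def by (rule Inf_lower) auto

lemma first_exit_antimono:
  "{c<..<d} \<subseteq> {c'<..<d'} \<Longrightarrow> first_exit c d w \<le> first_exit c' d' w"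
  unfolding first_exit_def by (rule Inf_superset_mono) blast

text \<open>By continuity the set of times outside the open interval is closed in the reals, so a
  nonempty one contains its infimum. The work lies in carrying this infimum over to
  \<open>ennreal\<close>, where an empty set has infimum \<open>\<top>\<close>.\<close>

lemma first_exit_cases:
  assumes w: "continuous_on {0..} w"
  obtains (never) "first_exit c d w = \<top>" "\<And>s. 0 \<le> s \<Longrightarrow> w s \<in> {c<..<d}"
  | (at) z where "0 \<le> z" "first_exit c d w = ennreal z" "w z \<notin> {c<..<d}"
      "\<And>s. 0 \<le> s \<Longrightarrow> s < z \<Longrightarrow> w s \<in> {c<..<d}"
proof -
  define Z where "Z = {t \<in> {0..}. w t \<in> - {c<..<d}}"
  have F: "first_exit c d w = Inf (ennreal ` Z)"
    by (auto simp: first_exit_def Z_def intro!: arg_cong[where f=Inf])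
  show thesis
  proof (cases "Z = {}")
    case True
    then show ?thesis using never F by (auto simp: Z_def)
  next
    case False
    have "closed Z"
      using continuous_closed_preimage[OF w, of "- {c<..<d}"]
      by (simp add: Z_def vimage_def Int_def closed_Compl del: Compl_iff)
    moreover have bdd: "bdd_below Z" by (rule bdd_belowI[of _ 0]) (auto simp: Z_def)
    ultimately have z: "Inf Z \<in> Z" using False by (intro closed_contains_Inf)
    have "first_exit c d w = ennreal (Inf Z)"
      unfolding F
    proof (rule antisym)
      show "Inf (ennreal ` Z) \<le> ennreal (Inf Z)" using z by (intro INF_lower)
      show "ennreal (Inf Z) \<le> Inf (ennreal ` Z)"
        using bdd by (intro INF_greatest ennreal_leI cInf_lower)
    qed
    moreover have "w s \<in> {c<..<d}" if "0 \<le> s" "s < Inf Z" for s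
      using cInf_lower[OF _ bdd, of s] that by (fastforce simp: Z_def)
    ultimately show ?thesis using at[of "Inf Z"] z by (auto simp: Z_def)
  qed
qed

text \<open>The infimum is attained, so the strict inequality includes time \<open>t\<close> itself.
  In this form the event depends only on the path up to \<open>t\<close>, which is what adaptedness
  will require.\<close>

lemma less_first_exit_iff:
  assumes "continuous_on {0..} w" "0 \<le> t"
  shows "ennreal t < first_exit c d w \<longleftrightarrow> (\<forall>s\<in>{0..t}. w s \<in> {c<..<d})"
  using assms(1)
proof (cases rule: first_exit_cases[where c=c and d=d])
  case (at z)
  then show ?thesis using \<open>0 \<le> t\<close> by (cases "t < z") (auto simp: ennreal_less_iff)
qed (auto simp: ennreal_less_top)

lemma first_exit_endpoint:
  assumes w: "continuous_on {0..} w" and "w 0 \<in> {c<..<d}" "0 \<le> z" and z: "first_exit c d w = ennreal z"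
  shows "w z \<in> {c, d}"
  using w
proof (cases rule: first_exit_cases[where c=c and d=d])
  case (at z')
  then have "z' = z" using z \<open>0 \<le> z\<close> by simp
  with at assms have "0 < z" by (cases "z = 0") auto
  \<comment> \<open>Since the start is inside the interval, \<open>z\<close> is positive and lies in
    the closure of \<open>{0..<z}\<close>. The limit position is then in the closed interval but
    outside the open one.\<close>
  have "w ` closure {0..<z} \<subseteq> {c..d}"
    using at(4) \<open>z' = z\<close> \<open>0 < z\<close>
    by (intro image_closure_subset) (force intro: continuous_on_subset[OF w])+
  then have "w z \<in> {c..d}" using \<open>0 < z\<close> by (auto simp: image_subset_iff)
  then show ?thesis using at(3) \<open>z' = z\<close> by force
qed (use z in auto)

lemma before_first_exit:
  assumes "continuous_on {0..} w" "w 0 \<in> {c<..<d}" "0 \<le> t" "ennreal t \<le> first_exit c d w"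
  shows "w t \<in> {c..d}"
proof (cases "ennreal t < first_exit c d w")
  case True
  then show ?thesis using less_first_exit_iff[OF assms(1,3)] assms(3) by (auto intro: less_imp_le)
next
  case False
  then have "w t \<in> {c, d}" using assms first_exit_endpoint by (metis antisym not_less)
  then show ?thesis using assms(2) by auto
qed

section \<open>Reflection of paths, and hitting times as exit times\<close>

lemma exit_time_reflect: "exit_time (\<lambda>t \<omega>. 1 - W t \<omega>) = exit_time W"
  unfolding exit_time_def by (intro ext arg_cong[where f=Inf]) auto

lemma killed_reflect: "killed (\<lambda>t \<omega>. 1 - W t \<omega>) t \<omega> = map_option (\<lambda>x. 1 - x) (killed W t \<omega>)"
  by (simp add: killed_def exit_time_reflect)

lemma extend_reflect: "extend (\<lambda>x. \<phi> (1 - x)) (map_option (\<lambda>x. 1 - x) z) = extend \<phi> z"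
  by (cases z) (auto simp: extend_def)

lemma hitting_time_reflect:
  "hitting_time (\<lambda>t \<omega>. 1 - W t \<omega>) A \<omega> = hitting_time W ((\<lambda>x. 1 - x) ` A) \<omega>"
proof -
  have "map_option (\<lambda>x. 1 - x) z \<in> Some ` A \<longleftrightarrow> z \<in> Some ` (\<lambda>x. 1 - x) ` A" for z :: "real option"
    by (cases z) (force simp: image_iff)+
  then show ?thesis by (simp add: hitting_time_def killed_reflect exit_time_reflect)
qed

text \<open>A path leaving \<open>(0, r)\<close> either enters \<open>[r, 1)\<close>, which is a
  hit, or reaches \<open>0\<close> or \<open>1\<close>, where it is killed and the convention for
  the empty set returns the same instant. For \<open>r = 1\<close> the target is never hit and only
  the convention acts. All random times of the game thereby become exit times from open
  intervals.\<close>

lemma hitting_time_right: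
  assumes w: "continuous_on {0..} (\<lambda>t. W t \<omega>)" and r: "0 < r" "r \<le> 1"
  shows "hitting_time W {r..1} \<omega> = first_exit 0 r (\<lambda>t. W t \<omega>)"
proof -
  let ?w = "\<lambda>t. W t \<omega>" and ?H = "{t. killed W t \<omega> \<in> Some ` {r..1}}"
  have le: "first_exit 0 r ?w \<le> exit_time W \<omega>"
    unfolding exit_time_eq_first_exit using r by (intro first_exit_antimono) auto
  have H: "first_exit 0 r ?w \<le> t" if "t \<in> ?H" for t
  proof -
    from that have "t < exit_time W \<omega>" "W (enn2real t) \<omega> \<ge> r" by (auto simp: killed_def split: if_splits)
    moreover from this have "t < \<top>" by (metis less_le_trans top_greatest)
    ultimately show ?thesis using first_exit_le[of "enn2real t" ?w 0 r] by simp
  qed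
  \<comment> \<open>Having left \<open>(0, r)\<close> but not yet \<open>(0, 1)\<close>, the path
    sits in \<open>[r, 1)\<close>.\<close>
  have mem: "first_exit 0 r ?w \<in> ?H" if lt: "first_exit 0 r ?w < exit_time W \<omega>"
    using w
  proof (cases rule: first_exit_cases[where c=0 and d=r])
    case (at z)
    with lt less_first_exit_iff[OF w \<open>0 \<le> z\<close>, of 0 1]
    have "W z \<omega> \<in> {0<..<1}" by (auto simp: exit_time_eq_first_exit)
    then show ?thesis using at lt by (auto simp: killed_def)
  qed (use lt in auto)
  show ?thesis
  proof (cases "?H = {}")
    case True
    with mem le have "first_exit 0 r ?w = exit_time W \<omega>" by fastforce
    with True show ?thesis by (auto simp: hitting_time_def)
  next
    case False
    then obtain t where t: "t \<in> ?H" by blast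
    then have "first_exit 0 r ?w < exit_time W \<omega>"
      using H[OF t] by (auto simp: killed_def split: if_splits)
    from mem[OF this] H have "Inf ?H = first_exit 0 r ?w" by (meson Inf_greatest Inf_lower antisym)
    then show ?thesis using t by (auto simp: hitting_time_def)
  qed
qed

lemma first_exit_reflect: "first_exit c d (\<lambda>t. 1 - w t) = first_exit (1 - d) (1 - c) w"
  unfolding first_exit_def by (intro arg_cong[where f=Inf]) auto

lemma hitting_time_left:
  assumes "continuous_on {0..} (\<lambda>t. W t \<omega>)" "0 \<le> l" "l < 1"
  shows "hitting_time W {0..l} \<omega> = first_exit l 1 (\<lambda>t. W t \<omega>)"
  using hitting_time_right[of "\<lambda>t \<omega>. 1 - W t \<omega>" \<omega> "1 - l", OF continuous_on_diff[OF continuous_on_const assms(1)]] assms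
  by (simp add: hitting_time_reflect first_exit_reflect)

text \<open>At the exit time itself the killed process is already at the cemetery, where the
  extension is 0, while \<open>W\<close> is at an endpoint. The boundary values of
  \<open>\<phi>\<close> reconcile the two, so rewards can be read off the unkilled path.\<close>

lemma extend_killed:
  assumes w: "continuous_on {0..} (\<lambda>t. W t \<omega>)" "W 0 \<omega> \<in> {0<..<1}"
    and t: "0 \<le> t" "ennreal t \<le> exit_time W \<omega>" and \<phi>: "\<phi> 0 = 0" "\<phi> 1 = 0"
  shows "extend \<phi> (killed W (ennreal t) \<omega>) = \<phi> (W t \<omega>)"
proof (cases "ennreal t < exit_time W \<omega>")
  case False
  then have "W t \<omega> \<in> {0, 1}"
    using first_exit_endpoint[OF w t(1)] t(2) by (auto simp: exit_time_eq_first_exit)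
  then show ?thesis using False \<phi> by (auto simp: killed_def extend_def)
qed (use t in \<open>simp add: killed_def extend_def\<close>)

section \<open>Optional stopping\<close>

context brownian_family
begin

lemma prob_space_P: "prob_space (P x)" and sets_P [measurable_cong]: "sets (P x) = sets M"
  using measurable_space[OF kernel, of x] by (auto simp: space_prob_algebra)

lemma space_P [simp]: "space (P x) = space M"
  by (rule sets_eq_imp_space_eq[OF sets_P])

lemma prob_space_Q: "prob_space (completion (P x))"
  by (intro prob_space.prob_space_completion prob_space_P)

lemma borel_measurable_G:
  fixes Y :: "'w \<Rightarrow> 'b::topological_space"
  shows "Y \<in> borel_measurable (G (ennreal t)) \<Longrightarrow> Y \<in> borel_measurable M"
proof -
  have "borel_measurable (G (ennreal t)) \<subseteq> (borel_measurable M :: ('w \<Rightarrow> _) set)"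
    by (rule measurable_mono[OF order_refl refl sets_G]) (simp add: space_F)
  then show "Y \<in> borel_measurable (G (ennreal t)) \<Longrightarrow> Y \<in> borel_measurable M" by blast
qed

lemma W_measurable [measurable]: "0 \<le> t \<Longrightarrow> W t \<in> borel_measurable M"
  using adapted borel_measurable_G by blast

lemma
  assumes "0 \<le> s" "s < t"
  shows increment_integrable: "integrable (P x) (\<lambda>\<omega>. W t \<omega> - W s \<omega>)"
    and increment_sq_integrable: "integrable (P x) (\<lambda>\<omega>. (W t \<omega> - W s \<omega>)\<^sup>2)"
    and increment_mean: "(\<integral>\<omega>. W t \<omega> - W s \<omega> \<partial>P x) = 0"
    and increment_variance: "(\<integral>\<omega>. (W t \<omega> - W s \<omega>)\<^sup>2 \<partial>P x) = t - s"
proof -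
  interpret prob_space "P x" by (rule prob_space_P)
  have \<sigma>: "0 < sqrt (t - s)" using assms by simp
  note D = normal_increments[OF assms, of x]
  show "integrable (P x) (\<lambda>\<omega>. W t \<omega> - W s \<omega>)"
    using integrable_normal_moment[OF \<sigma>, of 0 1] distributed_integrable[OF D, of "\<lambda>y. y"] by simp
  show "integrable (P x) (\<lambda>\<omega>. (W t \<omega> - W s \<omega>)\<^sup>2)"
    using integrable_normal_moment[OF \<sigma>, of 0 2] distributed_integrable[OF D, of "\<lambda>y. y\<^sup>2"] by simp
  show m: "(\<integral>\<omega>. W t \<omega> - W s \<omega> \<partial>P x) = 0"
    by (rule normal_distributed_expectation[OF \<sigma> D])
  show "(\<integral>\<omega>. (W t \<omega> - W s \<omega>)\<^sup>2 \<partial>P x) = t - s"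
    using normal_distributed_variance[OF \<sigma> D] m assms by simp
qed

lemma indep_var_increment:
  assumes Y: "Y \<in> borel_measurable (G (ennreal s))" and st: "0 \<le> s" "s < t"
  shows "prob_space.indep_var (P x) borel Y borel (\<lambda>\<omega>. W t \<omega> - W s \<omega>)"
proof -
  interpret prob_space "P x" by (rule prob_space_P)
  let ?D = "\<lambda>\<omega>. W t \<omega> - W s \<omega>"
  have [measurable]: "Y \<in> borel_measurable (P x)" "?D \<in> borel_measurable (P x)"
    using borel_measurable_G[OF Y] st by (auto simp: measurable_cong_sets[OF sets_P refl])
  have YG: "{Y -` A \<inter> space M |A. A \<in> sets borel} \<subseteq> sets (G (ennreal s))"
    using measurable_sets[OF Y] by (auto simp: space_F)
  have "sigma_sets (space M) {Y -` A \<inter> space M |A. A \<in> sets borel} \<subseteq> sets (G (ennreal s))"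
    using sets.sigma_sets_subset[OF YG] by (simp add: space_F)
  \<comment> \<open>The preimages of Borel sets already form a sigma-algebra, so the independence
    assumed for this family is independence of the generated one.\<close>
  moreover have "sigma_sets (space M) {?D -` A \<inter> space M |A. A \<in> sets borel}
      = {?D -` A \<inter> space M |A. A \<in> sets borel}"
    using sets_vimage_algebra[of "space M" ?D borel] sets_vimage_algebra2[of ?D "space M" borel] by auto
  ultimately show ?thesis
    using indep_increments[OF st, of x] unfolding indep_var_eq indep_sets2_eq
    by (auto simp: subset_iff)
qed

lemma
  assumes "Y \<in> borel_measurable (G (ennreal s))" "0 \<le> s" "s < t" "integrable (P x) Y"
  shows past_increment_integrable: "integrable (P x) (\<lambda>\<omega>. Y \<omega> * (W t \<omega> - W s \<omega>))"
    and past_increment_mean: "(\<integral>\<omega>. Y \<omega> * (W t \<omega> - W s \<omega>) \<partial>P x) = 0"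
  using prob_space.indep_var_integrable[OF prob_space_P indep_var_increment[OF assms(1-3)] assms(4)]
    prob_space.indep_var_lebesgue_integral[OF prob_space_P indep_var_increment[OF assms(1-3)] assms(4)]
    increment_integrable[OF assms(2,3)] increment_mean[OF assms(2,3)]
  by auto

text \<open>Each summand is an increment times something known before it, so means and cross terms
  vanish and only the squared increments, with variances \<open>t (Suc k) - t k\<close>, remain. The
  claims are proved together because killing the cross term at step \<open>n\<close> needs
  measurability and integrability of \<open>S n\<close>. With \<open>A k\<close> the event of not
  having stopped by \<open>t k\<close>, \<open>S n\<close> is the displacement up to a discretised
  stopping time.\<close>

lemma martingale_transform:
  fixes t :: "nat \<Rightarrow> real"
  assumes t: "0 \<le> t 0" "\<And>k. t k < t (Suc k)" and A: "\<And>k. A k \<in> sets (G (ennreal (t k)))"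
  defines "S \<equiv> \<lambda>n \<omega>. \<Sum>k<n. indicator (A k) \<omega> * (W (t (Suc k)) \<omega> - W (t k) \<omega>)"
  shows "S n \<in> borel_measurable (G (ennreal (t n))) \<and> integrable (P x) (S n)
    \<and> integrable (P x) (\<lambda>\<omega>. (S n \<omega>)\<^sup>2) \<and> (\<integral>\<omega>. S n \<omega> \<partial>P x) = 0
    \<and> (\<integral>\<omega>. (S n \<omega>)\<^sup>2 \<partial>P x) \<le> t n - t 0"
proof (induction n)
  case 0
  show ?case by (simp add: S_def)
next
  case (Suc n)
  interpret prob_space "P x" by (rule prob_space_P)
  let ?D = "\<lambda>\<omega>. W (t (Suc n)) \<omega> - W (t n) \<omega>" and ?I = "indicator (A n) :: 'w \<Rightarrow> real"
  have tn: "0 \<le> t n" "t n < t (Suc n)"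
    using t lift_Suc_mono_le[of t 0 n] by (force intro: less_imp_le)+
  have SG: "S n \<in> borel_measurable (G (ennreal (t n)))" and Sint: "integrable (P x) (S n)"
    using Suc by blast+
  have mono: "Y \<in> borel_measurable (G (ennreal (t (Suc n))))"
    if "Y \<in> borel_measurable (G (ennreal (t n)))" for Y :: "'w \<Rightarrow> real"
  proof -
    have "borel_measurable (G (ennreal (t n))) \<subseteq> (borel_measurable (G (ennreal (t (Suc n)))) :: ('w \<Rightarrow> real) set)"
      by (rule measurable_mono[OF order_refl refl]) (use tn in \<open>auto simp: space_F intro!: sets_F_mono ennreal_leI\<close>)
    then show ?thesis using that by blast
  qed
  have I: "?I \<in> borel_measurable (G (ennreal (t n)))" by (intro borel_measurable_indicator A)
  have [measurable]: "A n \<in> sets M" "S n \<in> borel_measurable M"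
    using A sets_G SG borel_measurable_G by blast+
  have Iint: "integrable (P x) ?I"
    by (rule integrable_const_bound[of _ 1]) (auto split: split_indicator)
  have SI: "integrable (P x) (\<lambda>\<omega>. S n \<omega> * ?I \<omega>)"
    by (rule Bochner_Integration.integrable_bound[OF Sint]) (auto split: split_indicator)
  have SIG: "(\<lambda>\<omega>. S n \<omega> * ?I \<omega>) \<in> borel_measurable (G (ennreal (t n)))"
    by (intro borel_measurable_times SG I)
  have DI: "integrable (P x) (\<lambda>\<omega>. ?I \<omega> * (?D \<omega>)\<^sup>2)"
    by (rule Bochner_Integration.integrable_bound[OF increment_sq_integrable[OF tn]])
      (use tn in \<open>auto split: split_indicator\<close>)
  have DIle: "(\<integral>\<omega>. ?I \<omega> * (?D \<omega>)\<^sup>2 \<partial>P x) \<le> t (Suc n) - t n"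
    unfolding increment_variance[OF tn, of x, symmetric]
    by (intro integral_mono DI increment_sq_integrable tn) (auto split: split_indicator)
  note c = past_increment_integrable[OF SIG tn SI] past_increment_mean[OF SIG tn SI]
  note d = past_increment_integrable[OF I tn Iint] past_increment_mean[OF I tn Iint]
  have S1: "S (Suc n) = (\<lambda>\<omega>. S n \<omega> + ?I \<omega> * ?D \<omega>)" by (simp only: S_def sum.lessThan_Suc)
  \<comment> \<open>An indicator equals its own square.\<close>
  have S2: "(\<lambda>\<omega>. (S (Suc n) \<omega>)\<^sup>2) = (\<lambda>\<omega>. (S n \<omega>)\<^sup>2 + 2 * (S n \<omega> * ?I \<omega> * ?D \<omega>) + ?I \<omega> * (?D \<omega>)\<^sup>2)"
  proof
    fix \<omega>
    show "(S (Suc n) \<omega>)\<^sup>2 = (S n \<omega>)\<^sup>2 + 2 * (S n \<omega> * ?I \<omega> * ?D \<omega>) + ?I \<omega> * (?D \<omega>)\<^sup>2"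
      unfolding S1 by (cases "\<omega> \<in> A n") (simp_all add: power2_sum)
  qed
  have S2int: "integrable (P x) (\<lambda>\<omega>. (S n \<omega>)\<^sup>2)" and S0: "(\<integral>\<omega>. S n \<omega> \<partial>P x) = 0"
    and S2le: "(\<integral>\<omega>. (S n \<omega>)\<^sup>2 \<partial>P x) \<le> t n - t 0"
    using Suc by blast+
  have "S (Suc n) \<in> borel_measurable (G (ennreal (t (Suc n))))"
    unfolding S1
    by (intro borel_measurable_add borel_measurable_times borel_measurable_diff mono[OF SG] mono[OF I]
      mono[OF adapted] adapted) (use tn in simp_all)
  moreover have "integrable (P x) (S (Suc n))" "(\<integral>\<omega>. S (Suc n) \<omega> \<partial>P x) = 0"
    unfolding S1 using Sint S0 d by simp_all
  moreover have "integrable (P x) (\<lambda>\<omega>. (S (Suc n) \<omega>)\<^sup>2)"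
    unfolding S2 by (intro Bochner_Integration.integrable_add integrable_mult_right S2int c DI)
  moreover have "(\<integral>\<omega>. (S (Suc n) \<omega>)\<^sup>2 \<partial>P x) \<le> t (Suc n) - t 0"
    unfolding S2 using S2int S2le c DI DIle by simp
  ultimately show ?case by blast
qed

end

text \<open>For \<open>s \<ge> 0\<close> this rounds \<open>s\<close> up to the grid of mesh
  \<open>1 / (m + 1)\<close>. Rounding up is essential: a grid point lies before the rounded time
  iff it lies before \<open>s\<close>, and for a stopping time that is known at the grid
  point.\<close>

definition grid_above :: "nat \<Rightarrow> real \<Rightarrow> real" where
  "grid_above m s = real (nat \<lceil>real (Suc m) * s\<rceil>) / real (Suc m)"

lemma grid_above_nonneg: "0 \<le> grid_above m s"
  by (simp add: grid_above_def)

lemma grid_above_tendsto: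
  assumes "0 \<le> s"
  shows "(\<lambda>m. grid_above m s) \<longlonglongrightarrow> s"
proof (rule tendsto_sandwich[where f="\<lambda>_. s" and h="\<lambda>m. s + inverse (real (Suc m))"])
  have *: "real (nat \<lceil>real (Suc m) * s\<rceil>) = of_int \<lceil>real (Suc m) * s\<rceil>" for m
  proof -
    have "0 \<le> real (Suc m) * s" using assms by simp
    then have "0 \<le> \<lceil>real (Suc m) * s\<rceil>" by linarith
    then show ?thesis by (rule of_nat_nat)
  qed
  show "\<forall>\<^sub>F m in sequentially. s \<le> grid_above m s"
    unfolding grid_above_def * by (intro always_eventually allI) (simp add: pos_le_divide_eq mult.commute)
  show "\<forall>\<^sub>F m in sequentially. grid_above m s \<le> s + inverse (real (Suc m))"
  proof (intro always_eventually allI)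
    fix m
    have "of_int \<lceil>real (Suc m) * s\<rceil> \<le> real (Suc m) * s + 1" by linarith
    then have "of_int \<lceil>real (Suc m) * s\<rceil> / real (Suc m) \<le> (real (Suc m) * s + 1) / real (Suc m)"
      by (intro divide_right_mono) auto
    also have "\<dots> = s + inverse (real (Suc m))" by (simp add: field_simps)
    finally show "grid_above m s \<le> s + inverse (real (Suc m))" unfolding grid_above_def * .
  qed
  show "(\<lambda>m. s + inverse (real (Suc m))) \<longlonglongrightarrow> s"
    using tendsto_add[OF tendsto_const LIMSEQ_inverse_real_of_nat, of s] by simp
qed auto

section \<open>Stopping at bounded times\<close>

context brownian_family
begin

lemma prob_space_M [simp]: "measure (P x) (space M) = 1"
  using prob_space.prob_space[OF prob_space_P, of x] by simp

lemma W_grid_above_tendsto: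
  assumes "\<omega> \<in> space M" "0 \<le> s"
  shows "(\<lambda>m. W (grid_above m s) \<omega>) \<longlonglongrightarrow> W s \<omega>"
  by (rule continuous_on_tendsto_compose[OF continuous_paths[OF assms(1)] grid_above_tendsto[OF assms(2)]])
    (use assms grid_above_nonneg in auto)

text \<open>The rounded time takes countably many values, so stopping there is measurable piece by
  piece; path continuity passes this to the limit.\<close>

lemma W_stopped_measurable:
  assumes [measurable]: "\<sigma> \<in> borel_measurable (completion (P x))"
    and nn: "\<And>\<omega>. \<omega> \<in> space M \<Longrightarrow> 0 \<le> \<sigma> \<omega>"
  shows "(\<lambda>\<omega>. W (\<sigma> \<omega>) \<omega>) \<in> borel_measurable (completion (P x))"
proof (rule borel_measurable_LIMSEQ_real)
  show "(\<lambda>m. W (grid_above m (\<sigma> \<omega>)) \<omega>) \<longlonglongrightarrow> W (\<sigma> \<omega>) \<omega>" if "\<omega> \<in> space (completion (P x))" for \<omega>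
    using that by (intro W_grid_above_tendsto nn) auto
  fix m
  have *: "W (real i / real (Suc m)) \<in> borel_measurable (completion (P x))" for i
    by (intro measurable_completion) (simp add: measurable_cong_sets[OF sets_P refl])
  show "(\<lambda>\<omega>. W (grid_above m (\<sigma> \<omega>)) \<omega>) \<in> borel_measurable (completion (P x))"
    unfolding grid_above_def by (rule measurable_compose_countable[OF *]) measurable
qed

text \<open>
  The overshoot of the discretised stopping time is unbounded; the uniform \<open>L\<^sup>2\<close> bound
  \<open>E Z\<^sup>2 \<le> B\<close> with \<open>\<bar>z\<bar> \<le> min \<bar>z\<bar> K + z\<^sup>2 / K\<close> takes the place of uniform integrability.
\<close>

lemma optional_stopping_bounded:
  fixes \<sigma> :: "'w \<Rightarrow> real" and N :: nat
  assumes meas: "\<sigma> \<in> borel_measurable (completion (P x))"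
    and bnd: "\<And>\<omega>. \<omega> \<in> space M \<Longrightarrow> 0 \<le> \<sigma> \<omega> \<and> \<sigma> \<omega> \<le> real N"
    and adp: "\<And>t. 0 \<le> t \<Longrightarrow> \<exists>A\<in>sets (G (ennreal t)). AE \<omega> in P x. t < \<sigma> \<omega> \<longleftrightarrow> \<omega> \<in> A"
    and C: "AE \<omega> in P x. \<bar>W (\<sigma> \<omega>) \<omega>\<bar> \<le> C"
  shows "(\<integral>\<omega>. W (\<sigma> \<omega>) \<omega> \<partial>completion (P x)) = x"
proof -
  interpret Q: prob_space "completion (P x)" by (rule prob_space_Q)
  define t where "t m k = real k / real (Suc m)" for m k :: nat
  have t: "0 \<le> t m 0" "t m k < t m (Suc k)" "0 \<le> t m k" for m k
    by (auto simp: t_def divide_strict_right_mono)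
  have "\<forall>m k. \<exists>A. A \<in> sets (G (ennreal (t m k))) \<and> (AE \<omega> in P x. t m k < \<sigma> \<omega> \<longleftrightarrow> \<omega> \<in> A)"
    using adp t(3) by blast
  then obtain A where A: "A m k \<in> sets (G (ennreal (t m k)))"
      "AE \<omega> in P x. t m k < \<sigma> \<omega> \<longleftrightarrow> \<omega> \<in> A m k" for m k
    by metis
  \<comment> \<open>With mesh \<open>1 / (m + 1)\<close>, \<open>N * Suc m\<close> steps reach
    exactly time \<open>N\<close>, the bound of \<open>\<sigma>\<close>; hence the second moment is
    at most \<open>N\<close> for every \<open>m\<close>.\<close>
  define S where "S m \<omega> = (\<Sum>k<N * Suc m. indicator (A m k) \<omega> * (W (t m (Suc k)) \<omega> - W (t m k) \<omega>))" for m \<omega>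
  note S = martingale_transform[where t="t m" and A="A m" and n="N * Suc m" and x=x for m,
      OF t(1,2) A(1), folded S_def]
  have S_M: "S m \<in> borel_measurable (P x)" "(\<lambda>\<omega>. (S m \<omega>)\<^sup>2) \<in> borel_measurable (P x)" for m
    using S[of m] by (auto dest: borel_measurable_integrable)
  have tN: "t m (N * Suc m) - t m 0 = real N" for m
    by (simp add: t_def del: of_nat_Suc mult_Suc_right)
  have S1: "integrable (completion (P x)) (S m)" "(\<integral>\<omega>. S m \<omega> \<partial>completion (P x)) = 0"
    and S2: "integrable (completion (P x)) (\<lambda>\<omega>. (S m \<omega>)\<^sup>2)"
      "(\<integral>\<omega>. (S m \<omega>)\<^sup>2 \<partial>completion (P x)) \<le> real N" for m
    using S[of m] S_M[of m] unfolding tN by (simp_all add: integrable_completion integral_completion)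
  \<comment> \<open>Outside one null set all \<open>A m k\<close> are the true events, and the
    surviving increments telescope up to the rounded time.\<close>
  have S_eq: "AE \<omega> in P x. \<forall>m. S m \<omega> = W (grid_above m (\<sigma> \<omega>)) \<omega> - x"
  proof -
    have "AE \<omega> in P x. \<forall>m k. t m k < \<sigma> \<omega> \<longleftrightarrow> \<omega> \<in> A m k"
      unfolding AE_all_countable using A(2) by blast
    then show ?thesis using start[of x] AE_space
    proof eventually_elim
      case (elim \<omega>)
      show ?case
      proof
        fix m
        define K where "K = nat \<lceil>real (Suc m) * \<sigma> \<omega>\<rceil>"
        have s: "0 \<le> \<sigma> \<omega>" "\<sigma> \<omega> \<le> real N" using bnd elim by auto
        have "real (Suc m) * \<sigma> \<omega> \<le> real (Suc m) * real N" using s by (intro mult_left_mono) auto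
        then have "\<lceil>real (Suc m) * \<sigma> \<omega>\<rceil> \<le> int (N * Suc m)"
          by (simp only: ceiling_le_iff of_int_mult of_int_of_nat_eq of_nat_mult mult.commute)
        then have "K \<le> N * Suc m" unfolding K_def by linarith
        moreover have "\<omega> \<in> A m k \<longleftrightarrow> k < K" for k
        proof -
          have "\<omega> \<in> A m k \<longleftrightarrow> real k < real (Suc m) * \<sigma> \<omega>"
            using elim(1) by (auto simp: t_def pos_divide_less_eq mult.commute)
          also have "\<dots> \<longleftrightarrow> k < K" unfolding K_def by linarith
          finally show ?thesis .
        qed
        ultimately have "S m \<omega> = (\<Sum>k<K. W (t m (Suc k)) \<omega> - W (t m k) \<omega>)"
          unfolding S_def by (intro sum.mono_neutral_cong_right) auto
        also have "\<dots> = W (t m K) \<omega> - W (t m 0) \<omega>" by (rule sum_lessThan_telescope)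
        finally show "S m \<omega> = W (grid_above m (\<sigma> \<omega>)) \<omega> - x"
          using elim(2) by (simp add: t_def grid_above_def K_def)
      qed
    qed
  qed
  define V where "V \<omega> = W (\<sigma> \<omega>) \<omega>" for \<omega>
  define Z where "Z m \<omega> = S m \<omega> + x - V \<omega>" for m \<omega>
  have Vm [measurable]: "V \<in> borel_measurable (completion (P x))" unfolding V_def by (rule W_stopped_measurable[OF meas]) (use bnd in auto)
  have VC: "AE \<omega> in completion (P x). \<bar>V \<omega>\<bar> \<le> C" using C by (simp add: V_def AE_completion)
  have Vi: "integrable (completion (P x)) V"
    using VC by (intro Q.integrable_const_bound[of _ C]) auto
  have Zi: "integrable (completion (P x)) (Z m)" and Ze: "(\<integral>\<omega>. Z m \<omega> \<partial>completion (P x)) = x - (\<integral>\<omega>. V \<omega> \<partial>completion (P x))" for m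
    unfolding Z_def using S1 Vi by simp_all
  note [measurable] = borel_measurable_integrable[OF Zi]
  \<comment> \<open>From \<open>(u + v)\<^sup>2 \<le> 2 * u\<^sup>2 + 2 * v\<^sup>2\<close> with
    \<open>u = S m\<close> and \<open>v = x - V\<close>; independence of \<open>m\<close> is the
    point.\<close>
  define B where "B = 2 * real N + 2 * (\<bar>x\<bar> + C)\<^sup>2"
  have Z2: "AE \<omega> in completion (P x). (Z m \<omega>)\<^sup>2 \<le> 2 * (S m \<omega>)\<^sup>2 + 2 * (\<bar>x\<bar> + C)\<^sup>2" for m
    using VC
  proof eventually_elim
    case (elim \<omega>)
    have "(Z m \<omega>)\<^sup>2 \<le> 2 * (S m \<omega>)\<^sup>2 + 2 * (x - V \<omega>)\<^sup>2"
      using sum_squares_ge_zero[of "S m \<omega> - (x - V \<omega>)" 0]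
      by (simp add: Z_def power2_eq_square algebra_simps)
    moreover have "(x - V \<omega>)\<^sup>2 \<le> (\<bar>x\<bar> + C)\<^sup>2"
      using elim by (intro abs_le_square_iff[THEN iffD1]) auto
    ultimately show ?case by linarith
  qed
  have Bi: "integrable (completion (P x)) (\<lambda>\<omega>. 2 * (S m \<omega>)\<^sup>2 + 2 * (\<bar>x\<bar> + C)\<^sup>2)" for m
    using S2 by simp
  have Z2i: "integrable (completion (P x)) (\<lambda>\<omega>. (Z m \<omega>)\<^sup>2)" for m
    by (rule Bochner_Integration.integrable_bound[OF Bi[of m]]) (use Z2[of m] in \<open>auto\<close>)
  have Z2B: "(\<integral>\<omega>. (Z m \<omega>)\<^sup>2 \<partial>completion (P x)) \<le> B" for m
  proof -
    have "(\<integral>\<omega>. (Z m \<omega>)\<^sup>2 \<partial>completion (P x)) \<le> (\<integral>\<omega>. 2 * (S m \<omega>)\<^sup>2 + 2 * (\<bar>x\<bar> + C)\<^sup>2 \<partial>completion (P x))"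
      by (rule integral_mono_AE[OF Z2i Bi Z2])
    also have "\<dots> \<le> B" using S2[of m] by (simp add: B_def)
    finally show ?thesis .
  qed
  have Z0: "AE \<omega> in completion (P x). (\<lambda>m. Z m \<omega>) \<longlonglongrightarrow> 0"
    using AE_completion[OF S_eq] AE_space
  proof eventually_elim
    case (elim \<omega>)
    then have "(\<lambda>m. W (grid_above m (\<sigma> \<omega>)) \<omega>) \<longlonglongrightarrow> V \<omega>"
      unfolding V_def using bnd by (intro W_grid_above_tendsto) auto
    from tendsto_diff[OF this tendsto_const[of "V \<omega>"]] show ?case using elim by (simp add: Z_def)
  qed
  \<comment> \<open>For fixed \<open>K\<close> the truncated part vanishes as \<open>m\<close>
    grows, by dominated convergence. Only afterwards does \<open>K\<close> tend to infinity.\<close>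
  have le: "\<bar>x - (\<integral>\<omega>. V \<omega> \<partial>completion (P x))\<bar> \<le> B / K" if K: "K > 0" for K
  proof -
    have mi: "integrable (completion (P x)) (\<lambda>\<omega>. min \<bar>Z m \<omega>\<bar> K)" for m
      by (rule Q.integrable_const_bound[of _ K]) (use K in auto)
    have "(\<lambda>m. \<integral>\<omega>. min \<bar>Z m \<omega>\<bar> K \<partial>completion (P x)) \<longlonglongrightarrow> (\<integral>\<omega>. 0 \<partial>completion (P x))"
    proof (rule integral_dominated_convergence[where w="\<lambda>_. K"])
      show "AE \<omega> in completion (P x). (\<lambda>m. min \<bar>Z m \<omega>\<bar> K) \<longlonglongrightarrow> 0"
        using Z0
      proof eventually_elim
        case (elim \<omega>)
        from tendsto_min[OF tendsto_rabs[OF elim] tendsto_const[of K]] show ?case using K by simp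
      qed
    qed (use K in auto)
    from tendsto_add[OF this tendsto_const[of "B / K"]]
    have "(\<lambda>m. (\<integral>\<omega>. min \<bar>Z m \<omega>\<bar> K \<partial>completion (P x)) + B / K) \<longlonglongrightarrow> B / K" by simp
    moreover have "\<bar>x - (\<integral>\<omega>. V \<omega> \<partial>completion (P x))\<bar> \<le> (\<integral>\<omega>. min \<bar>Z m \<omega>\<bar> K \<partial>completion (P x)) + B / K" for m
    proof -
      have "\<bar>x - (\<integral>\<omega>. V \<omega> \<partial>completion (P x))\<bar> \<le> (\<integral>\<omega>. \<bar>Z m \<omega>\<bar> \<partial>completion (P x))"
        unfolding Ze[of m, symmetric] by (rule integral_abs_bound)
      also have "\<dots> \<le> (\<integral>\<omega>. min \<bar>Z m \<omega>\<bar> K + (Z m \<omega>)\<^sup>2 / K \<partial>completion (P x))"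
      proof (rule integral_mono)
        fix \<omega>
        show "\<bar>Z m \<omega>\<bar> \<le> min \<bar>Z m \<omega>\<bar> K + (Z m \<omega>)\<^sup>2 / K"
        proof (cases "\<bar>Z m \<omega>\<bar> \<le> K")
          case False
          then have "\<bar>Z m \<omega>\<bar> * K \<le> \<bar>Z m \<omega>\<bar> * \<bar>Z m \<omega>\<bar>" by (intro mult_left_mono) auto
          then have "\<bar>Z m \<omega>\<bar> \<le> (Z m \<omega>)\<^sup>2 / K" using K by (simp add: pos_le_divide_eq power2_eq_square)
          then show ?thesis using K by (simp add: min_def)
        qed (use K in simp)
      qed (use Zi mi Z2i in auto)
      also have "\<dots> = (\<integral>\<omega>. min \<bar>Z m \<omega>\<bar> K \<partial>completion (P x)) + (\<integral>\<omega>. (Z m \<omega>)\<^sup>2 \<partial>completion (P x)) / K"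
        using mi Z2i by simp
      also have "\<dots> \<le> (\<integral>\<omega>. min \<bar>Z m \<omega>\<bar> K \<partial>completion (P x)) + B / K"
        using Z2B K by (intro add_left_mono divide_right_mono) auto
      finally show ?thesis .
    qed
    ultimately show ?thesis by (intro LIMSEQ_le_const) auto
  qed
  have "(\<lambda>n. B * inverse (real (Suc n))) \<longlonglongrightarrow> B * 0"
    by (intro tendsto_mult tendsto_const LIMSEQ_inverse_real_of_nat)
  then have "\<bar>x - (\<integral>\<omega>. V \<omega> \<partial>completion (P x))\<bar> \<le> B * 0"
    by (rule LIMSEQ_le_const) (use le[of "real (Suc n)" for n] in \<open>auto simp: divide_inverse\<close>)
  then show ?thesis by (simp add: V_def)
qed

end

text \<open>On the compact \<open>[0, t]\<close> a path inside \<open>(c, d)\<close> attains its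
  extremes and so keeps a distance \<open>1 / (n + 1)\<close> from the ends. Conversely, this closed
  condition extends from the dense sample times to all of \<open>[0, t]\<close>. The factor
  \<open>min 1\<close> keeps every sample time at most \<open>t\<close>.\<close>

lemma first_exit_countable:
  assumes w: "continuous_on {0..} w" and t: "0 \<le> t"
  shows "ennreal t < first_exit c d w \<longleftrightarrow>
    (\<exists>n. \<forall>m k. w (t * min 1 (real k / real (Suc m))) \<in> {c + inverse (real (Suc n))..d - inverse (real (Suc n))})"
  unfolding less_first_exit_iff[OF w t]
proof
  assume in_Ioo: "\<forall>s\<in>{0..t}. w s \<in> {c<..<d}"
  have K: "compact {0..t}" "{0..t} \<noteq> {}" "continuous_on {0..t} w"
    using t by (auto intro: continuous_on_subset[OF w])
  obtain u where u: "u \<in> {0..t}" "\<forall>s\<in>{0..t}. w u \<le> w s" using continuous_attains_inf[OF K] by blast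
  obtain v where v: "v \<in> {0..t}" "\<forall>s\<in>{0..t}. w s \<le> w v" using continuous_attains_sup[OF K] by blast
  have "0 < min (w u - c) (d - w v)" using in_Ioo u(1) v(1) by auto
  then obtain n where n: "inverse (real (Suc n)) < min (w u - c) (d - w v)" using reals_Archimedean by blast
  have "w s \<in> {c + inverse (real (Suc n))..d - inverse (real (Suc n))}" if "s \<in> {0..t}" for s
  proof -
    have "w u \<le> w s" "w s \<le> w v" using that u(2) v(2) by auto
    then show ?thesis using n unfolding min_less_iff_conj atLeastAtMost_iff by linarith
  qed
  moreover have "t * min 1 (real k / real (Suc m)) \<in> {0..t}" for m k
    using t mult_left_le[of "min 1 (real k / real (Suc m))" t] by auto
  ultimately show "\<exists>n. \<forall>m k. w (t * min 1 (real k / real (Suc m))) \<in> {c + inverse (real (Suc n))..d - inverse (real (Suc n))}"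
    by blast
next
  assume "\<exists>n. \<forall>m k. w (t * min 1 (real k / real (Suc m))) \<in> {c + inverse (real (Suc n))..d - inverse (real (Suc n))}"
  then obtain n where n: "w (t * min 1 (real k / real (Suc m))) \<in> {c + inverse (real (Suc n))..d - inverse (real (Suc n))}"
    for m k by blast
  show "\<forall>s\<in>{0..t}. w s \<in> {c<..<d}"
  proof
    fix s assume s: "s \<in> {0..t}"
    \<comment> \<open>The sample times are \<open>t\<close> times a fraction, so \<open>s\<close> is
      approximated by rounding its fraction of \<open>t\<close>. For \<open>t = 0\<close> only
      \<open>s = 0\<close> occurs.\<close>
    define u where "u = (if t = 0 then 0 else s / t)"
    have u: "0 \<le> u" "min 1 u = u" "t * u = s" using s by (auto simp: u_def)
    have "(\<lambda>m. t * min 1 (grid_above m u)) \<longlonglongrightarrow> t * min 1 u"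
      using u by (intro tendsto_mult tendsto_min tendsto_const grid_above_tendsto)
    then have "(\<lambda>m. t * min 1 (grid_above m u)) \<longlonglongrightarrow> s" using u by simp
    then have "(\<lambda>m. w (t * min 1 (grid_above m u))) \<longlonglongrightarrow> w s"
      by (rule continuous_on_tendsto_compose[OF w]) (use s t grid_above_nonneg in auto)
    then have "w s \<in> {c + inverse (real (Suc n))..d - inverse (real (Suc n))}"
      by (rule Lim_in_closed_set[OF closed_atLeastAtMost, rotated 2])
        (use n in \<open>auto simp: grid_above_def\<close>)
    moreover have "0 < inverse (real (Suc n))" by simp
    ultimately show "w s \<in> {c<..<d}" unfolding atLeastAtMost_iff greaterThanLessThan_iff by linarith
  qed
qed

section \<open>Adaptedness and finiteness of exit times\<close>

context brownian_family
begin

lemma first_exit_adapted: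
  assumes "0 \<le> t"
  shows "{\<omega> \<in> space M. ennreal t < first_exit c d (\<lambda>t. W t \<omega>)} \<in> sets (G (ennreal t))"
proof -
  have meas: "W (t * min 1 (real k / real (Suc m))) \<in> borel_measurable (G (ennreal t))" for m k
  proof -
    let ?s = "t * min 1 (real k / real (Suc m))"
    have s: "0 \<le> ?s" "?s \<le> t" using assms mult_left_le[of "min 1 (real k / real (Suc m))" t] by auto
    have "borel_measurable (G (ennreal ?s)) \<subseteq> (borel_measurable (G (ennreal t)) :: ('w \<Rightarrow> real) set)"
      by (rule measurable_mono[OF order_refl refl]) (use s in \<open>auto simp: space_F intro!: sets_F_mono ennreal_leI\<close>)
    then show ?thesis using adapted[OF s(1)] by blast
  qed
  have "{\<omega> \<in> space (G (ennreal t)). \<exists>n. \<forall>m k. W (t * min 1 (real k / real (Suc m))) \<omega> \<in>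
      {c + inverse (real (Suc n))..d - inverse (real (Suc n))}} \<in> sets (G (ennreal t))"
    by (intro sets.sets_Collect_countable_Ex sets.sets_Collect_countable_All measurable_sets_Collect[OF meas]) simp
  also have "{\<omega> \<in> space (G (ennreal t)). \<exists>n. \<forall>m k. W (t * min 1 (real k / real (Suc m))) \<omega> \<in>
      {c + inverse (real (Suc n))..d - inverse (real (Suc n))}}
    = {\<omega> \<in> space M. ennreal t < first_exit c d (\<lambda>t. W t \<omega>)}"
    using first_exit_countable[OF continuous_paths assms] by (auto simp: space_F)
  finally show ?thesis .
qed

text \<open>A path that never leaves \<open>(0, 1)\<close> has \<open>W (n + 1) - W 0\<close> in
  \<open>[-1, 1]\<close> for every \<open>n\<close>, and the probability of each such event is of
  order \<open>1 / sqrt (n + 1)\<close> as the Gaussian density flattens.\<close>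

lemma exit_time_finite: "AE \<omega> in P x. exit_time W \<omega> < \<top>"
proof -
  interpret prob_space "P x" by (rule prob_space_P)
  define B where "B n = (\<lambda>\<omega>. W (real (Suc n)) \<omega> - W 0 \<omega>) -` {-1..1} \<inter> space (P x)" for n
  have B: "B n \<in> sets (P x)" for n
    unfolding B_def by (rule measurable_sets[where A=borel]) (auto simp: measurable_cong_sets[OF sets_P refl] simp del: of_nat_Suc)
  have le: "prob (B n) \<le> 2 / sqrt (2 * pi) * sqrt (inverse (real (Suc n)))" for n
  proof -
    \<comment> \<open>The peak of the normal density with variance \<open>n + 1\<close>; the factor
      2 below is the length of \<open>[-1, 1]\<close>.\<close>
    let ?c = "1 / sqrt (2 * pi * real (Suc n))"
    have D: "distributed (P x) lborel (\<lambda>\<omega>. W (real (Suc n)) \<omega> - W 0 \<omega>) (normal_density 0 (sqrt (real (Suc n))))"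
      using normal_increments[of 0 "real (Suc n)" x] by simp
    have dens: "normal_density 0 (sqrt (real (Suc n))) y \<le> ?c" for y
      unfolding normal_density_def by (simp del: of_nat_Suc add: divide_right_mono)
    have "emeasure (P x) (B n) = (\<integral>\<^sup>+y. ennreal (normal_density 0 (sqrt (real (Suc n))) y) * indicator {-1..1} y \<partial>lborel)"
      unfolding B_def by (rule distributed_emeasure[OF D]) auto
    also have "\<dots> \<le> (\<integral>\<^sup>+y. ennreal ?c * indicator {-1..1::real} y \<partial>lborel)"
      using dens by (intro nn_integral_mono mult_right_mono ennreal_leI) auto
    also have "\<dots> = ennreal ?c * ennreal 2"
      by (subst nn_integral_cmult_indicator) auto
    also have "\<dots> = ennreal (?c * 2)" by (rule ennreal_mult''[symmetric]) simp
    finally have "prob (B n) \<le> ?c * 2"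
      by (simp add: emeasure_eq_measure del: of_nat_Suc)
    then show ?thesis by (simp add: real_sqrt_mult real_sqrt_inverse divide_inverse del: of_nat_Suc)
  qed
  have "(\<lambda>n. 2 / sqrt (2 * pi) * sqrt (inverse (real (Suc n)))) \<longlonglongrightarrow> 2 / sqrt (2 * pi) * sqrt 0"
    by (intro tendsto_mult tendsto_const tendsto_real_sqrt LIMSEQ_inverse_real_of_nat)
  moreover have "\<exists>N. \<forall>n\<ge>N. prob (\<Inter>n. B n) \<le> 2 / sqrt (2 * pi) * sqrt (inverse (real (Suc n)))"
  proof (intro exI allI impI)
    fix n
    have "prob (\<Inter>n. B n) \<le> prob (B n)" using B by (intro finite_measure_mono) auto
    with le[of n] show "prob (\<Inter>n. B n) \<le> 2 / sqrt (2 * pi) * sqrt (inverse (real (Suc n)))" by linarith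
  qed
  ultimately have "prob (\<Inter>n. B n) \<le> 2 / sqrt (2 * pi) * sqrt 0"
    by (rule LIMSEQ_le_const)
  then have "prob (\<Inter>n. B n) = 0" by (intro antisym) simp_all
  then have "(\<Inter>n. B n) \<in> null_sets (P x)"
    using B by (intro null_setsI) (auto simp: emeasure_eq_measure)
  then show ?thesis
  proof (rule AE_I')
    show "{\<omega> \<in> space (P x). \<not> exit_time W \<omega> < \<top>} \<subseteq> (\<Inter>n. B n)"
    proof clarify
      fix \<omega> n assume \<omega>: "\<omega> \<in> space (P x)" "\<not> exit_time W \<omega> < \<top>"
      then have "W s \<omega> \<in> {0<..<1}" if "0 \<le> s" for s
        using less_first_exit_iff[OF continuous_paths that, of \<omega> 0 1] that
        by (auto simp: exit_time_eq_first_exit less_top[symmetric])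
      from this[of 0] this[of "real (Suc n)"] \<omega> show "\<omega> \<in> B n" by (auto simp: B_def simp del: of_nat_Suc)
    qed
  qed
qed

text \<open>
  All that is used of the universally completed filtration: under each single law \<open>P x\<close> its events
  agree almost surely with raw ones.
\<close>

definition ess_stopping :: "real \<Rightarrow> ('w \<Rightarrow> ennreal) \<Rightarrow> bool" where
  "ess_stopping x T \<longleftrightarrow> T \<in> borel_measurable (completion (P x)) \<and>
     (\<forall>t\<ge>0. \<exists>A\<in>sets (G (ennreal t)). AE \<omega> in P x. ennreal t < T \<omega> \<longleftrightarrow> \<omega> \<in> A)"

text \<open>Measurability comes for free: each event of \<open>T\<close> differs from a raw one by a
  null set, hence belongs to the completion.\<close>

lemma ess_stoppingI:
  assumes T: "\<And>t. 0 \<le> t \<Longrightarrow> \<exists>A\<in>sets (G (ennreal t)). AE \<omega> in P x. ennreal t < T \<omega> \<longleftrightarrow> \<omega> \<in> A"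
  shows "ess_stopping x T"
proof -
  have "{\<omega> \<in> space (completion (P x)). T \<omega> \<le> y} \<in> sets (completion (P x))" for y
  proof (cases y)
    case (real t)
    then obtain A where A: "A \<in> sets (G (ennreal t))" "AE \<omega> in P x. ennreal t < T \<omega> \<longleftrightarrow> \<omega> \<in> A"
      using T by blast
    \<comment> \<open>The symmetric difference is null, hence measurable; the event is recovered
      from it and \<open>A\<close> by exclusive or.\<close>
    have 1: "Measurable.pred (completion (P x)) (\<lambda>\<omega>. (ennreal t < T \<omega>) \<noteq> (\<omega> \<in> A))"
      by (rule sets_completion_AE) (use A in simp)
    have "A \<in> sets (completion (P x))" using A sets_G sets_P by blast
    then have 2: "Measurable.pred (completion (P x)) (\<lambda>\<omega>. \<omega> \<in> A)" by simp
    have "(\<lambda>\<omega>. T \<omega> \<le> y) = (\<lambda>\<omega>. ((ennreal t < T \<omega>) \<noteq> (\<omega> \<in> A)) = (\<omega> \<in> A))"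
      using real by (auto simp: not_less[symmetric] fun_eq_iff)
    then have "Measurable.pred (completion (P x)) (\<lambda>\<omega>. T \<omega> \<le> y)" using 1 2 by simp
    then show ?thesis by (simp add: pred_def)
  qed simp
  then have "T \<in> borel_measurable (completion (P x))" by (rule borel_measurableI_le)
  then show ?thesis using T by (auto simp: ess_stopping_def)
qed

lemma ess_stopping_min:
  assumes "ess_stopping x S" "ess_stopping x T"
  shows "ess_stopping x (\<lambda>\<omega>. min (S \<omega>) (T \<omega>))"
proof (rule ess_stoppingI)
  fix t :: real assume "0 \<le> t"
  then obtain A B where A: "A \<in> sets (G (ennreal t))" "AE \<omega> in P x. ennreal t < S \<omega> \<longleftrightarrow> \<omega> \<in> A"
    and B: "B \<in> sets (G (ennreal t))" "AE \<omega> in P x. ennreal t < T \<omega> \<longleftrightarrow> \<omega> \<in> B"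
    using assms unfolding ess_stopping_def by metis
  from A(2) B(2) have "AE \<omega> in P x. ennreal t < min (S \<omega>) (T \<omega>) \<longleftrightarrow> \<omega> \<in> A \<inter> B"
    by eventually_elim auto
  with A B show "\<exists>A\<in>sets (G (ennreal t)). AE \<omega> in P x. ennreal t < min (S \<omega>) (T \<omega>) \<longleftrightarrow> \<omega> \<in> A"
    by blast
qed

section \<open>The universal completion seen under a single law\<close>

lemma bind_return_P: "return borel x \<bind> P = P x"
  using bind_return[OF measurable_prob_algebraD[OF kernel], of x] by simp

lemma completed_sets_Pow: "sets (G t) \<union> null_sets (completion (P x)) \<subseteq> Pow (space M)"
  using sets.space_closed[of "G t"] sets.space_closed[of "completion (P x)"]
  by (auto simp: space_F dest!: null_setsD2)

lemma sets_universal_completion: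
  "sets (universal_completion M P G t) = sigma_sets (space M)
     (\<Inter>\<mu>\<in>{\<mu> :: real measure. prob_space \<mu> \<and> sets \<mu> = sets borel}.
        sigma_sets (space M) (sets (G t) \<union> null_sets (completion (\<mu> \<bind> P))))"
  and space_universal_completion: "space (universal_completion M P G t) = space M"
proof -
  \<comment> \<open>\<open>sigma\<close> generates the intended sets only from subsets of the space.
    One member of the intersection shows this; the point mass at 0 is an arbitrary choice.\<close>
  have "sigma_sets (space M) (sets (G t) \<union> null_sets (completion (return borel 0 \<bind> P))) \<subseteq> Pow (space M)"
    unfolding bind_return_P using sigma_sets_into_sp[OF completed_sets_Pow] by blast
  then have "(\<Inter>\<mu>\<in>{\<mu> :: real measure. prob_space \<mu> \<and> sets \<mu> = sets borel}.
        sigma_sets (space M) (sets (G t) \<union> null_sets (completion (\<mu> \<bind> P)))) \<subseteq> Pow (space M)"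
    using prob_space_return[of 0 "borel :: real measure"]
    by (intro INF_lower2[of "return borel 0"]) auto
  then show "sets (universal_completion M P G t) = sigma_sets (space M)
     (\<Inter>\<mu>\<in>{\<mu> :: real measure. prob_space \<mu> \<and> sets \<mu> = sets borel}.
        sigma_sets (space M) (sets (G t) \<union> null_sets (completion (\<mu> \<bind> P))))"
    and "space (universal_completion M P G t) = space M"
    unfolding universal_completion_def by (simp_all add: sets_measure_of space_measure_of)
qed

text \<open>The intersection over all initial laws lies in its member for the point mass at
  \<open>x\<close>, whose mixed law is \<open>P x\<close>. Sets almost surely equal to raw ones
  include the raw sets and the null sets, and are stable under complement and countable union, so
  induction over the generated sigma-algebra applies.\<close>

lemma universal_completion_AE:
  assumes "B \<in> sets (universal_completion M P G t)"
  shows "\<exists>A\<in>sets (G t). AE \<omega> in P x. \<omega> \<in> B \<longleftrightarrow> \<omega> \<in> A"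
proof -
  have "(\<Inter>\<mu>\<in>{\<mu> :: real measure. prob_space \<mu> \<and> sets \<mu> = sets borel}.
        sigma_sets (space M) (sets (G t) \<union> null_sets (completion (\<mu> \<bind> P))))
    \<subseteq> sigma_sets (space M) (sets (G t) \<union> null_sets (completion (return borel x \<bind> P)))"
    using prob_space_return[of x "borel :: real measure"] by (intro INF_lower) auto
  also note bind_return_P
  finally have "B \<in> sigma_sets (space M) (sigma_sets (space M) (sets (G t) \<union> null_sets (completion (P x))))"
    using assms sigma_sets_mono' unfolding sets_universal_completion by blast
  then have "B \<in> sigma_sets (space M) (sets (G t) \<union> null_sets (completion (P x)))"
    by (simp add: sigma_sets_sigma_sets_eq[OF completed_sets_Pow])
  then show ?thesis
  proof induction
    case (Basic B)
    then show ?case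
    proof
      assume "B \<in> null_sets (completion (P x))"
      then have "AE \<omega> in P x. \<omega> \<notin> B" using AE_not_in AE_completion_iff by blast
      then show ?thesis by (intro bexI[of _ "{}"]) auto
    qed auto
  next
    case (Compl B)
    then obtain A where A: "A \<in> sets (G t)" "AE \<omega> in P x. \<omega> \<in> B \<longleftrightarrow> \<omega> \<in> A" by blast
    then have "space M - A \<in> sets (G t)" using sets.compl_sets[OF A(1)] by (simp add: space_F)
    moreover have "AE \<omega> in P x. \<omega> \<in> space M - B \<longleftrightarrow> \<omega> \<in> space M - A" using A(2) by eventually_elim auto
    ultimately show ?case by blast
  next
    case (Union B)
    then obtain A where A: "A i \<in> sets (G t)" "AE \<omega> in P x. \<omega> \<in> B i \<longleftrightarrow> \<omega> \<in> A i" for i :: nat by metis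
    from A(2) have "AE \<omega> in P x. \<forall>i. \<omega> \<in> B i \<longleftrightarrow> \<omega> \<in> A i" by (simp add: AE_all_countable)
    then have "AE \<omega> in P x. \<omega> \<in> (\<Union>i. B i) \<longleftrightarrow> \<omega> \<in> (\<Union>i. A i)" by eventually_elim auto
    moreover have "(\<Union>i. A i) \<in> sets (G t)" using A(1) by auto
    ultimately show ?case by blast
  qed (auto intro: bexI[of _ "{}"])
qed

lemma stopping_times_ess_stopping:
  assumes "\<tau> \<in> stopping_times M P G"
  shows "ess_stopping x \<tau>"
proof (rule ess_stoppingI)
  fix t :: real
  have "{\<omega> \<in> space M. ennreal t < \<tau> \<omega>} \<in> sets (universal_completion M P G (ennreal t))"
    using assms stopping_timeD2[of "universal_completion M P G" \<tau> "ennreal t"]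
    by (simp add: stopping_times_def pred_def space_universal_completion)
  from universal_completion_AE[OF this, of x] obtain A where A: "A \<in> sets (G (ennreal t))"
    "AE \<omega> in P x. \<omega> \<in> {\<omega> \<in> space M. ennreal t < \<tau> \<omega>} \<longleftrightarrow> \<omega> \<in> A" by blast
  have "AE \<omega> in P x. ennreal t < \<tau> \<omega> \<longleftrightarrow> \<omega> \<in> A"
    using A(2) AE_space by eventually_elim auto
  then show "\<exists>A\<in>sets (G (ennreal t)). AE \<omega> in P x. ennreal t < \<tau> \<omega> \<longleftrightarrow> \<omega> \<in> A" using A(1) by blast
qed

text \<open>Stated for any time agreeing with an exit time on \<open>space M\<close>, because
  hitting times are identified with exit times only along continuous paths.\<close>

lemma first_exit_stopping_times:
  assumes \<tau>: "\<And>\<omega>. \<omega> \<in> space M \<Longrightarrow> \<tau> \<omega> = first_exit c d (\<lambda>t. W t \<omega>)"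
  shows "\<tau> \<in> stopping_times M P G"
  unfolding stopping_times_def mem_Collect_eq
proof (rule stopping_timeI)
  fix t :: ennreal
  have "{\<omega> \<in> space M. \<tau> \<omega> \<le> t} \<in> sets (universal_completion M P G t)"
  proof (cases t)
    case (real s)
    have "{\<omega> \<in> space M. \<tau> \<omega> \<le> t} = space (G t) - {\<omega> \<in> space M. ennreal s < first_exit c d (\<lambda>t. W t \<omega>)}"
      using \<tau> real by (auto simp: space_F not_less)
    also have "\<dots> \<in> sets (G t)" using first_exit_adapted real by auto
    finally show ?thesis unfolding sets_universal_completion by (intro sigma_sets.Basic INT_I) (auto intro: sigma_sets.Basic)
  next
    case top
    then show ?thesis using sets.top[of "universal_completion M P G t"] by (simp add: space_universal_completion)
  qed
  then show "Measurable.pred (universal_completion M P G t) (\<lambda>\<omega>. \<tau> \<omega> \<le> t)"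
    by (simp add: pred_def space_universal_completion)
qed

lemma hitting_time_right_eq:
  "0 < r \<Longrightarrow> r \<le> 1 \<Longrightarrow> \<omega> \<in> space M \<Longrightarrow> hitting_time W {r..1} \<omega> = first_exit 0 r (\<lambda>t. W t \<omega>)"
  by (rule hitting_time_right[OF continuous_paths])

lemma hitting_time_left_eq:
  "0 \<le> l \<Longrightarrow> l < 1 \<Longrightarrow> \<omega> \<in> space M \<Longrightarrow> hitting_time W {0..l} \<omega> = first_exit l 1 (\<lambda>t. W t \<omega>)"
  by (rule hitting_time_left[OF continuous_paths])

lemma hitting_time_right_stopping: "0 < r \<Longrightarrow> r \<le> 1 \<Longrightarrow> hitting_time W {r..1} \<in> stopping_times M P G"
  by (rule first_exit_stopping_times[OF hitting_time_right_eq])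

lemma hitting_time_left_stopping: "0 \<le> l \<Longrightarrow> l < 1 \<Longrightarrow> hitting_time W {0..l} \<in> stopping_times M P G"
  by (rule first_exit_stopping_times[OF hitting_time_left_eq])

text \<open>Up to the exit from \<open>(0, 1)\<close> the path stays in \<open>[0, 1]\<close>, so 1
  bounds all stopped positions. The bounded case applies to \<open>T\<close> cut off at
  \<open>N\<close>; since \<open>T\<close> is almost surely finite, the cut-off times eventually
  equal \<open>T\<close>, and dominated convergence finishes.\<close>

lemma
  assumes T: "ess_stopping x T" and le: "\<And>\<omega>. \<omega> \<in> space M \<Longrightarrow> T \<omega> \<le> exit_time W \<omega>" and x: "0 < x" "x < 1"
  shows stopped_integrable: "integrable (completion (P x)) (\<lambda>\<omega>. W (enn2real (T \<omega>)) \<omega>)"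
    and optional_stopping: "(\<integral>\<omega>. W (enn2real (T \<omega>)) \<omega> \<partial>completion (P x)) = x"
proof -
  interpret Q: prob_space "completion (P x)" by (rule prob_space_Q)
  have [measurable]: "T \<in> borel_measurable (completion (P x))" using T by (simp add: ess_stopping_def)
  have bound: "AE \<omega> in P x. \<forall>s\<ge>0. ennreal s \<le> T \<omega> \<longrightarrow> \<bar>W s \<omega>\<bar> \<le> 1"
    using start[of x] AE_space
  proof eventually_elim
    case (elim \<omega>)
    show ?case
    proof (intro allI impI)
      fix s assume "0 \<le> s" "ennreal s \<le> T \<omega>"
      then have "W s \<omega> \<in> {0..1}"
        using elim x le[of \<omega>] by (intro before_first_exit[of "\<lambda>t. W t \<omega>"] continuous_paths)
          (auto simp flip: exit_time_eq_first_exit)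
      then show "\<bar>W s \<omega>\<bar> \<le> 1" by auto
    qed
  qed
  have fin: "AE \<omega> in P x. T \<omega> < \<top>"
    using exit_time_finite[of x] AE_space by eventually_elim (use le le_less_trans in auto)
  define \<sigma> where "\<sigma> N \<omega> = enn2real (min (T \<omega>) (of_nat N))" for N \<omega>
  have \<sigma>: "ennreal (\<sigma> N \<omega>) = min (T \<omega>) (of_nat N)" for N \<omega>
    unfolding \<sigma>_def by (intro ennreal_enn2real) (simp add: min_less_iff_disj of_nat_less_top)
  have \<sigma>_nn: "0 \<le> \<sigma> N \<omega>" for N \<omega> by (simp add: \<sigma>_def)
  have \<sigma>_le: "\<sigma> N \<omega> \<le> real N" for N \<omega>
    using \<sigma>[of N \<omega>] by (metis ennreal_le_iff ennreal_of_nat_eq_real_of_nat min.cobounded2 of_nat_0_le_iff)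
  have \<sigma>_less: "t < \<sigma> N \<omega> \<longleftrightarrow> ennreal t < T \<omega> \<and> t < real N" if "0 \<le> t" for t N \<omega>
    using that by (subst ennreal_less_iff[symmetric]) (auto simp: \<sigma> ennreal_of_nat_eq_real_of_nat ennreal_less_iff)
  have [measurable]: "\<sigma> N \<in> borel_measurable (completion (P x))" for N unfolding \<sigma>_def by measurable
  have \<sigma>_bound: "AE \<omega> in P x. \<forall>N. \<bar>W (\<sigma> N \<omega>) \<omega>\<bar> \<le> 1"
    using bound by eventually_elim (simp add: \<sigma>_nn \<sigma>)
  have mean: "(\<integral>\<omega>. W (\<sigma> N \<omega>) \<omega> \<partial>completion (P x)) = x" for N
  proof (rule optional_stopping_bounded)
    show "AE \<omega> in P x. \<bar>W (\<sigma> N \<omega>) \<omega>\<bar> \<le> 1" using \<sigma>_bound by eventually_elim auto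
    show "\<exists>A\<in>sets (G (ennreal t)). AE \<omega> in P x. t < \<sigma> N \<omega> \<longleftrightarrow> \<omega> \<in> A" if t: "0 \<le> t" for t
    proof (cases "t < real N")
      case True
      then show ?thesis using T t unfolding ess_stopping_def by (simp add: \<sigma>_less)
    next
      case False
      \<comment> \<open>From time \<open>N\<close> on the cut-off time has certainly passed, so the
        event is empty.\<close>
      then show ?thesis using t by (intro bexI[of _ "{}"]) (auto simp: \<sigma>_less)
    qed
  qed (use \<sigma>_nn \<sigma>_le in auto)
  have Vm [measurable]: "(\<lambda>\<omega>. W (enn2real (T \<omega>)) \<omega>) \<in> borel_measurable (completion (P x))"
    by (rule W_stopped_measurable) auto
  have Vb: "AE \<omega> in completion (P x). \<bar>W (enn2real (T \<omega>)) \<omega>\<bar> \<le> 1"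
    using AE_completion[OF bound] AE_completion[OF fin] by eventually_elim auto
  show "integrable (completion (P x)) (\<lambda>\<omega>. W (enn2real (T \<omega>)) \<omega>)"
    by (rule Q.integrable_const_bound[of _ 1]) (use Vb in auto)
  have "(\<lambda>N. \<integral>\<omega>. W (\<sigma> N \<omega>) \<omega> \<partial>completion (P x)) \<longlonglongrightarrow> (\<integral>\<omega>. W (enn2real (T \<omega>)) \<omega> \<partial>completion (P x))"
  proof (rule integral_dominated_convergence[where w="\<lambda>_. 1"])
    show "(\<lambda>\<omega>. W (\<sigma> N \<omega>) \<omega>) \<in> borel_measurable (completion (P x))" for N
      by (rule W_stopped_measurable) (auto simp: \<sigma>_nn)
    show "AE \<omega> in completion (P x). (\<lambda>N. W (\<sigma> N \<omega>) \<omega>) \<longlonglongrightarrow> W (enn2real (T \<omega>)) \<omega>"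
      using AE_completion[OF fin]
    proof eventually_elim
      case (elim \<omega>)
      then obtain N0 :: nat where N0: "T \<omega> < of_nat N0" using ennreal_Ex_less_of_nat by blast
      have "\<sigma> N \<omega> = enn2real (T \<omega>)" if "N0 \<le> N" for N
      proof -
        have "(of_nat N0 :: ennreal) \<le> of_nat N" using that by simp
        with N0 have "T \<omega> \<le> of_nat N" by (rule order_trans[OF less_imp_le])
        then show ?thesis unfolding \<sigma>_def by (simp add: min_absorb1)
      qed
      then show ?case by (intro tendsto_eventually eventually_sequentiallyI[of N0]) auto
    qed
    show "AE \<omega> in completion (P x). norm (W (\<sigma> N \<omega>) \<omega>) \<le> 1" for N
      using AE_completion[OF \<sigma>_bound] by eventually_elim auto
  qed auto
  then show "(\<integral>\<omega>. W (enn2real (T \<omega>)) \<omega> \<partial>completion (P x)) = x"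
    using mean LIMSEQ_unique[OF _ tendsto_const] by simp
qed

end

section \<open>Payoffs of threshold strategies\<close>

definition reward ::
  "(real \<Rightarrow> real) \<Rightarrow> (real \<Rightarrow> real) \<Rightarrow> (real \<Rightarrow> real) \<Rightarrow> (ennreal \<Rightarrow> real option) \<Rightarrow> ennreal \<Rightarrow> ennreal \<Rightarrow> real"
  where "reward f g h X s t =
    (if s < t then extend f (X s) else if t < s then extend g (X t) else extend h (X s))"

lemma reward_eq_sum:
  "reward f g h X (s \<omega>) (t \<omega>) = extend f (X (s \<omega>)) * indicator {\<omega>. s \<omega> < t \<omega>} \<omega>
    + extend g (X (t \<omega>)) * indicator {\<omega>. t \<omega> < s \<omega>} \<omega>
    + extend h (X (s \<omega>)) * indicator {\<omega>. s \<omega> = t \<omega>} \<omega>"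
  by (auto simp: reward_def)

lemma game_payoff_1:
  "game_payoff P W f g h 1 x \<tau> \<sigma>
    = (\<integral>\<omega>. reward (f 1) (g 1) (h 1) (\<lambda>t. killed W t \<omega>) (\<tau> \<omega>) (\<sigma> \<omega>) \<partial>completion (P x))"
  unfolding game_payoff_def Let_def reward_eq_sum by simp

lemma game_payoff_2:
  "game_payoff P W f g h 2 x \<sigma> \<tau>
    = (\<integral>\<omega>. reward (f 2) (g 2) (h 2) (\<lambda>t. killed W t \<omega>) (\<tau> \<omega>) (\<sigma> \<omega>) \<partial>completion (P x))"
  unfolding game_payoff_def Let_def reward_eq_sum by simp

text \<open>
  The game as seen by one player: in \<open>J x \<tau> \<sigma>\<close> the own stopping time \<open>\<tau>\<close> comes first, whichever
  player this is.
\<close>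

locale stopping_game = brownian_family M G P W
  for M :: "'w measure" and G P W +
  fixes f g h :: "real \<Rightarrow> real"
  assumes cont_f: "continuous_on {0..1} f" and cont_g: "continuous_on {0..1} g"
    and cont_h: "continuous_on {0..1} h"
    and f_le_h: "x \<in> {0..1} \<Longrightarrow> f x \<le> h x" and h_le_g: "x \<in> {0..1} \<Longrightarrow> h x \<le> g x"
    and boundary: "f 0 = 0" "f 1 = 0" "g 0 = 0" "g 1 = 0" "h 0 = 0" "h 1 = 0"
begin

abbreviation R :: "('w \<Rightarrow> ennreal) \<Rightarrow> ('w \<Rightarrow> ennreal) \<Rightarrow> 'w \<Rightarrow> real" where
  "R \<tau> \<sigma> \<omega> \<equiv> reward f g h (\<lambda>t. killed W t \<omega>) (\<tau> \<omega>) (\<sigma> \<omega>)"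

definition J :: "real \<Rightarrow> ('w \<Rightarrow> ennreal) \<Rightarrow> ('w \<Rightarrow> ennreal) \<Rightarrow> real" where
  "J x \<tau> \<sigma> = (\<integral>\<omega>. R \<tau> \<sigma> \<omega> \<partial>completion (P x))"

abbreviation D_left :: "real \<Rightarrow> 'w \<Rightarrow> ennreal" where "D_left l \<equiv> hitting_time W {0..l}"
abbreviation D_right :: "real \<Rightarrow> 'w \<Rightarrow> ennreal" where "D_right r \<equiv> hitting_time W {r..1}"

lemma f_le_g: "x \<in> {0..1} \<Longrightarrow> f x \<le> g x"
  using f_le_h h_le_g by (rule order_trans)

lemma exit_time_measurable: "exit_time W \<in> borel_measurable (completion (P x))"
proof -
  have "exit_time W \<in> stopping_times M P G"
    by (rule first_exit_stopping_times) (rule exit_time_eq_first_exit)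
  then show ?thesis using stopping_times_ess_stopping[of "exit_time W" x] by (simp add: ess_stopping_def)
qed

lemma extend_killed_measurable:
  assumes \<phi>: "continuous_on {0..1} \<phi>" and [measurable]: "\<tau> \<in> borel_measurable (completion (P x))"
  shows "(\<lambda>\<omega>. extend \<phi> (killed W (\<tau> \<omega>) \<omega>)) \<in> borel_measurable (completion (P x))"
proof -
  note [measurable] = exit_time_measurable
  \<comment> \<open>\<open>\<phi>\<close> is controlled on \<open>[0, 1]\<close> only. Clamping the
    argument gives a function continuous on the whole line with the same values at all positions
    before the exit.\<close>
  define \<psi> where "\<psi> y = \<phi> (max 0 (min 1 y))" for y
  have "continuous_on UNIV \<psi>"
    unfolding \<psi>_def by (rule continuous_on_compose2[OF \<phi>]) (auto intro!: continuous_intros)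
  then have [measurable]: "\<psi> \<in> borel_measurable borel" by (rule borel_measurable_continuous_onI)
  have [measurable]: "(\<lambda>\<omega>. W (enn2real (\<tau> \<omega>)) \<omega>) \<in> borel_measurable (completion (P x))"
    by (rule W_stopped_measurable) auto
  have "extend \<phi> (killed W (\<tau> \<omega>) \<omega>) = (if \<tau> \<omega> < exit_time W \<omega> then \<psi> (W (enn2real (\<tau> \<omega>)) \<omega>) else 0)"
    if "\<omega> \<in> space M" for \<omega>
  proof (cases "\<tau> \<omega> < exit_time W \<omega>")
    case True
    then have "\<tau> \<omega> < \<top>" by (metis less_le_trans top_greatest)
    then have "ennreal (enn2real (\<tau> \<omega>)) < exit_time W \<omega>" using True by simp
    then have "W (enn2real (\<tau> \<omega>)) \<omega> \<in> {0<..<1}"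
      using less_first_exit_iff[OF continuous_paths[OF that], of "enn2real (\<tau> \<omega>)" 0 1]
      by (auto simp: exit_time_eq_first_exit)
    then show ?thesis using True by (simp add: killed_def extend_def \<psi>_def max_def min_def)
  qed (simp add: killed_def extend_def)
  then show ?thesis by (subst measurable_cong) auto
qed

lemma reward_measurable:
  assumes [measurable]: "\<tau> \<in> borel_measurable (completion (P x))" "\<sigma> \<in> borel_measurable (completion (P x))"
  shows "R \<tau> \<sigma> \<in> borel_measurable (completion (P x))"
proof -
  note [measurable] = extend_killed_measurable[OF cont_f] extend_killed_measurable[OF cont_g]
    extend_killed_measurable[OF cont_h]
  show ?thesis unfolding reward_def by measurable
qed

lemma stopping_times_measurable: "\<tau> \<in> stopping_times M P G \<Longrightarrow> \<tau> \<in> borel_measurable (completion (P x))"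
  using stopping_times_ess_stopping[of \<tau> x] by (simp add: ess_stopping_def)

lemma reward_bounded: "\<exists>K. \<forall>\<omega>\<in>space M. \<forall>\<tau> \<sigma>. \<bar>R \<tau> \<sigma> \<omega>\<bar> \<le> K"
proof -
  have "\<exists>K. \<forall>x\<in>{0..1}. \<bar>\<phi> x\<bar> \<le> K" if "continuous_on {0..1} \<phi>" for \<phi> :: "real \<Rightarrow> real"
    using compact_imp_bounded[OF compact_continuous_image[OF that compact_Icc]]
    by (auto simp: bounded_iff)
  then obtain Kf Kg Kh where K: "\<forall>x\<in>{0..1}. \<bar>f x\<bar> \<le> Kf" "\<forall>x\<in>{0..1}. \<bar>g x\<bar> \<le> Kg" "\<forall>x\<in>{0..1}. \<bar>h x\<bar> \<le> Kh"
    using cont_f cont_g cont_h by metis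
  have ext: "\<bar>extend \<phi> (killed W t \<omega>)\<bar> \<le> K" if K: "\<forall>x\<in>{0..1}. \<bar>\<phi> x\<bar> \<le> K" and \<omega>: "\<omega> \<in> space M" for \<phi> t \<omega> K
  proof (cases "t < exit_time W \<omega>")
    case True
    then have "t < \<top>" by (metis less_le_trans top_greatest)
    then have "ennreal (enn2real t) < exit_time W \<omega>" using True by simp
    then have "W (enn2real t) \<omega> \<in> {0<..<1}"
      using less_first_exit_iff[OF continuous_paths[OF \<omega>], of "enn2real t" 0 1]
      by (auto simp: exit_time_eq_first_exit)
    then show ?thesis using True K by (simp add: killed_def extend_def)
  next
    case False
    \<comment> \<open>Serves to make \<open>K\<close> nonnegative, as the killed reward is
      0.\<close>
    have "\<bar>\<phi> 0\<bar> \<le> K" using K by simp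
    then show ?thesis using False by (simp add: killed_def extend_def)
  qed
  have "\<bar>R \<tau> \<sigma> \<omega>\<bar> \<le> max Kf (max Kg Kh)" if "\<omega> \<in> space M" for \<tau> \<sigma> \<omega>
    using ext[OF K(1) that, of "\<tau> \<omega>"] ext[OF K(2) that, of "\<sigma> \<omega>"] ext[OF K(3) that, of "\<tau> \<omega>"]
    by (auto simp: reward_def)
  then show ?thesis by blast
qed

lemma reward_integrable:
  assumes "\<tau> \<in> stopping_times M P G" "\<sigma> \<in> stopping_times M P G"
  shows "integrable (completion (P x)) (R \<tau> \<sigma>)"
proof -
  interpret Q: prob_space "completion (P x)" by (rule prob_space_Q)
  obtain K where "\<forall>\<omega>\<in>space M. \<forall>\<tau> \<sigma>. \<bar>R \<tau> \<sigma> \<omega>\<bar> \<le> K" using reward_bounded by blast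
  then show ?thesis
    using reward_measurable[OF stopping_times_measurable[OF assms(1)] stopping_times_measurable[OF assms(2)], of x]
    by (intro Q.integrable_const_bound[of _ K]) auto
qed

text \<open>A real supremum bounds its members only if the family is bounded; this is what turns the
  equation with \<open>SUP\<close> into inequalities for single strategies.\<close>

lemma J_bdd_above:
  assumes \<sigma>: "\<sigma> \<in> stopping_times M P G"
  shows "bdd_above ((\<lambda>\<tau>. J x \<tau> \<sigma>) ` stopping_times M P G)"
proof -
  interpret Q: prob_space "completion (P x)" by (rule prob_space_Q)
  obtain K where K: "\<forall>\<omega>\<in>space M. \<forall>\<tau> \<sigma>. \<bar>R \<tau> \<sigma> \<omega>\<bar> \<le> K" using reward_bounded by blast
  have "J x \<tau> \<sigma> \<le> K" if "\<tau> \<in> stopping_times M P G" for \<tau>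
    unfolding J_def using K reward_integrable[OF that \<sigma>, of x]
    by (intro Q.integral_le_const) (auto simp: abs_le_iff)
  then show ?thesis by (intro bdd_aboveI2)
qed

lemma J_eqI:
  assumes "\<tau> \<in> stopping_times M P G" "\<sigma> \<in> stopping_times M P G"
    and "\<And>\<omega>. \<omega> \<in> space M \<Longrightarrow> W 0 \<omega> = x \<Longrightarrow> R \<tau> \<sigma> \<omega> = c"
  shows "J x \<tau> \<sigma> = c"
proof -
  have "AE \<omega> in completion (P x). R \<tau> \<sigma> \<omega> = c"
    using AE_completion[OF start[of x]] AE_space by eventually_elim (use assms(3) in auto)
  then have "J x \<tau> \<sigma> = (\<integral>\<omega>. c \<partial>completion (P x))"
    unfolding J_def using reward_measurable assms(1,2) stopping_times_measurable
    by (intro integral_cong_AE) auto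
  then show ?thesis by simp
qed

lemma J_leI:
  assumes "\<tau> \<in> stopping_times M P G" "\<sigma> \<in> stopping_times M P G"
    and "\<And>\<omega>. \<omega> \<in> space M \<Longrightarrow> W 0 \<omega> = x \<Longrightarrow> R \<tau> \<sigma> \<omega> \<le> c"
  shows "J x \<tau> \<sigma> \<le> c"
proof -
  interpret Q: prob_space "completion (P x)" by (rule prob_space_Q)
  have "AE \<omega> in completion (P x). R \<tau> \<sigma> \<omega> \<le> c"
    using AE_completion[OF start[of x]] AE_space by eventually_elim (use assms(3) in auto)
  then show ?thesis unfolding J_def using reward_integrable[OF assms(1,2)] by (intro Q.integral_le_const) auto
qed

section \<open>Starting points from which the game ends at once\<close>

lemma exit_time_zero: "W 0 \<omega> \<notin> {0<..<1} \<Longrightarrow> exit_time W \<omega> = 0"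
  using first_exit_le[of 0 "\<lambda>t. W t \<omega>" 0 1] by (simp add: exit_time_eq_first_exit)

lemma J_boundary:
  assumes "\<tau> \<in> stopping_times M P G" "\<sigma> \<in> stopping_times M P G" "x \<in> {0, 1}"
  shows "J x \<tau> \<sigma> = 0"
  using assms by (intro J_eqI) (auto simp: reward_def killed_def extend_def exit_time_zero)

lemma first_exit_eq_0_iff:
  assumes "\<omega> \<in> space M"
  shows "first_exit c d (\<lambda>t. W t \<omega>) = 0 \<longleftrightarrow> W 0 \<omega> \<notin> {c<..<d}"
  using less_first_exit_iff[OF continuous_paths[OF assms], of 0 c d] by (auto simp: zero_less_iff_neq_zero)

lemma extend_killed_0:
  assumes "\<omega> \<in> space M" "W 0 \<omega> \<in> {0<..<1}"
  shows "extend \<phi> (killed W 0 \<omega>) = \<phi> (W 0 \<omega>)"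
  using first_exit_eq_0_iff[OF assms(1), of 0 1] assms(2)
  by (simp add: killed_def extend_def exit_time_eq_first_exit zero_less_iff_neq_zero)

lemma D_right_eq_0_iff:
  "0 < r \<Longrightarrow> r \<le> 1 \<Longrightarrow> \<omega> \<in> space M \<Longrightarrow> D_right r \<omega> = 0 \<longleftrightarrow> W 0 \<omega> \<notin> {0<..<r}"
  by (simp add: hitting_time_right_eq first_exit_eq_0_iff)

lemma D_left_eq_0_iff:
  "0 \<le> l \<Longrightarrow> l < 1 \<Longrightarrow> \<omega> \<in> space M \<Longrightarrow> D_left l \<omega> = 0 \<longleftrightarrow> W 0 \<omega> \<notin> {l<..<1}"
  by (simp add: hitting_time_left_eq first_exit_eq_0_iff)

lemma J_right:
  assumes r: "0 < r" "r \<le> x" "x < 1" and l: "0 \<le> l" "l < x"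
  shows "J x (D_left l) (D_right r) = g x"
proof (rule J_eqI)
  fix \<omega> assume \<omega>: "\<omega> \<in> space M" "W 0 \<omega> = x"
  then have "D_right r \<omega> = 0" "D_left l \<omega> \<noteq> 0"
    using assms D_right_eq_0_iff[of r \<omega>] D_left_eq_0_iff[of l \<omega>] by auto
  then show "R (D_left l) (D_right r) \<omega> = g x"
    using \<omega> assms extend_killed_0[of \<omega> g] by (simp add: reward_def zero_less_iff_neq_zero)
qed (use assms in \<open>auto intro: hitting_time_right_stopping hitting_time_left_stopping\<close>)

text \<open>The opponent stops at time 0. Waiting earns \<open>g x\<close>, stopping at once ties
  and earns \<open>h x\<close>, which is no more.\<close>

lemma J_right_le:
  assumes \<tau>: "\<tau> \<in> stopping_times M P G" and r: "0 < r" "r \<le> x" "x < 1"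
  shows "J x \<tau> (D_right r) \<le> g x"
proof (rule J_leI)
  fix \<omega> assume \<omega>: "\<omega> \<in> space M" "W 0 \<omega> = x"
  then have "D_right r \<omega> = 0" using r D_right_eq_0_iff[of r \<omega>] by auto
  then show "R \<tau> (D_right r) \<omega> \<le> g x"
    using \<omega> r extend_killed_0[of \<omega> g] extend_killed_0[of \<omega> h] h_le_g[of x]
    by (simp add: reward_def zero_less_iff_neq_zero)
qed (use assms in \<open>auto intro: hitting_time_right_stopping\<close>)

lemma J_left:
  assumes r: "x < r" "r \<le> 1" and l: "0 < x" "x \<le> l" "l < 1"
  shows "J x (D_left l) (D_right r) = f x"
proof (rule J_eqI)
  fix \<omega> assume \<omega>: "\<omega> \<in> space M" "W 0 \<omega> = x"
  then have "D_right r \<omega> \<noteq> 0" "D_left l \<omega> = 0"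
    using assms D_right_eq_0_iff[of r \<omega>] D_left_eq_0_iff[of l \<omega>] by auto
  then show "R (D_left l) (D_right r) \<omega> = f x"
    using \<omega> assms extend_killed_0[of \<omega> f] by (simp add: reward_def zero_less_iff_neq_zero)
qed (use assms in \<open>auto intro: hitting_time_right_stopping hitting_time_left_stopping\<close>)

section \<open>Starting points from which the path has to move\<close>

lemma extend_killed_stopped:
  assumes "\<omega> \<in> space M" "W 0 \<omega> \<in> {0<..<1}" "t < \<top>" "t \<le> exit_time W \<omega>" "\<phi> 0 = 0" "\<phi> 1 = 0"
  shows "extend \<phi> (killed W t \<omega>) = \<phi> (W (enn2real t) \<omega>)"
  using extend_killed[where W=W and \<omega>=\<omega> and t="enn2real t" and \<phi>=\<phi>] continuous_paths[of \<omega>] assms by simp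

lemma stopped_at_endpoint:
  assumes "\<omega> \<in> space M" "W 0 \<omega> \<in> {c<..<d}" "first_exit c d (\<lambda>t. W t \<omega>) < \<top>"
  shows "W (enn2real (first_exit c d (\<lambda>t. W t \<omega>))) \<omega> \<in> {c, d}"
  using assms by (intro first_exit_endpoint[of "\<lambda>t. W t \<omega>", OF continuous_paths]) auto

lemma stopped_before:
  assumes "\<omega> \<in> space M" "t < first_exit c d (\<lambda>t. W t \<omega>)"
  shows "t < \<top>" "W (enn2real t) \<omega> \<in> {c<..<d}"
proof -
  show "t < \<top>" using assms(2) by (metis less_le_trans top_greatest)
  then show "W (enn2real t) \<omega> \<in> {c<..<d}"
    using assms less_first_exit_iff[OF continuous_paths[OF assms(1)], of "enn2real t" c d] by auto
qed

lemma D_right_le_exit: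
  "0 < r \<Longrightarrow> r \<le> 1 \<Longrightarrow> \<omega> \<in> space M \<Longrightarrow> D_right r \<omega> \<le> exit_time W \<omega>"
  unfolding hitting_time_right_eq exit_time_eq_first_exit by (rule first_exit_antimono) auto

lemma integral_affine_stopped:
  assumes \<sigma>: "ess_stopping x \<sigma>" "\<And>\<omega>. \<omega> \<in> space M \<Longrightarrow> \<sigma> \<omega> \<le> exit_time W \<omega>" and x: "0 < x" "x < 1"
  shows "integrable (completion (P x)) (\<lambda>\<omega>. p + q * W (enn2real (\<sigma> \<omega>)) \<omega>)"
    and "(\<integral>\<omega>. p + q * W (enn2real (\<sigma> \<omega>)) \<omega> \<partial>completion (P x)) = p + q * x"
proof -
  interpret Q: prob_space "completion (P x)" by (rule prob_space_Q)
  note [simp] = stopped_integrable[OF assms] optional_stopping[OF assms]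
  show "integrable (completion (P x)) (\<lambda>\<omega>. p + q * W (enn2real (\<sigma> \<omega>)) \<omega>)" by simp
  show "(\<integral>\<omega>. p + q * W (enn2real (\<sigma> \<omega>)) \<omega> \<partial>completion (P x)) = p + q * x" by simp
qed

text \<open>Play ends at the minimum of both times. Before the opponent stops the position is in
  \<open>(0, r)\<close> and \<open>f\<close> is dominated; when the opponent stops it is
  \<open>0\<close> or \<open>r\<close>, and ties cost nothing as \<open>h \<le> g\<close>. The
  dominating function is affine, so its mean at the end is its value at \<open>x\<close>.\<close>

lemma J_le_affine:
  assumes \<tau>: "\<tau> \<in> stopping_times M P G" and x: "0 < x" "x < r" and r: "r \<le> 1"
    and f_le: "\<And>y. y \<in> {0..r} \<Longrightarrow> f y \<le> p + q * y" and g_le: "g r \<le> p + q * r"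
  shows "J x \<tau> (D_right r) \<le> p + q * x"
proof -
  define T where "T \<omega> = min (\<tau> \<omega>) (D_right r \<omega>)" for \<omega>
  have D: "D_right r \<in> stopping_times M P G" using x r by (intro hitting_time_right_stopping) auto
  have T: "ess_stopping x T"
    unfolding T_def by (intro ess_stopping_min stopping_times_ess_stopping \<tau> D)
  have T_le: "T \<omega> \<le> exit_time W \<omega>" if "\<omega> \<in> space M" for \<omega>
    using D_right_le_exit[of r \<omega>] x r that by (auto simp: T_def intro: min.coboundedI2)
  \<comment> \<open>Handles paths that end at 0, where every reward is 0.\<close>
  have p: "0 \<le> p" using f_le[of 0] x boundary by simp
  have "AE \<omega> in completion (P x). R \<tau> (D_right r) \<omega> \<le> p + q * W (enn2real (T \<omega>)) \<omega>"
    using AE_completion[OF start[of x]] AE_completion[OF exit_time_finite[of x]] AE_space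
  proof eventually_elim
    case (elim \<omega>)
    then have \<omega>: "\<omega> \<in> space M" and D_eq: "D_right r \<omega> = first_exit 0 r (\<lambda>t. W t \<omega>)"
      using x r by (auto simp: hitting_time_right_eq)
    have D_exit: "D_right r \<omega> \<le> exit_time W \<omega>" using \<omega> x r by (intro D_right_le_exit) auto
    have W0: "W 0 \<omega> \<in> {0<..<1}" "W 0 \<omega> \<in> {0<..<r}" using elim x r by auto
    have ext: "extend \<phi> (killed W t \<omega>) = \<phi> (W (enn2real t) \<omega>)"
      if "t \<le> D_right r \<omega>" "\<phi> 0 = 0" "\<phi> 1 = 0" for \<phi> t
      using \<omega> W0 elim(2) that D_exit by (intro extend_killed_stopped) auto
    have at_D: "W (enn2real (D_right r \<omega>)) \<omega> \<in> {0, r}"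
      using stopped_at_endpoint[OF \<omega> W0(2)] elim(2) D_exit by (auto simp: D_eq)
    show ?case
    proof (cases "\<tau> \<omega> < D_right r \<omega>")
      case True
      then have "W (enn2real (\<tau> \<omega>)) \<omega> \<in> {0..r}" using stopped_before(2)[OF \<omega>, of "\<tau> \<omega>" 0 r] by (auto simp: D_eq)
      with True show ?thesis using f_le ext[of "\<tau> \<omega>" f] boundary by (auto simp: reward_def T_def min_def)
    next
      case False
      then have T_D: "T \<omega> = D_right r \<omega>" by (simp add: T_def)
      let ?y = "W (enn2real (D_right r \<omega>)) \<omega>"
      have "R \<tau> (D_right r) \<omega> = (if D_right r \<omega> < \<tau> \<omega> then g ?y else h ?y)"
        using False ext[of "D_right r \<omega>"] boundary by (auto simp: reward_def)
      also have "\<dots> \<le> g ?y" using at_D h_le_g[of ?y] x r by auto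
      also have "\<dots> \<le> p + q * ?y" using at_D g_le p boundary by auto
      finally show ?thesis by (simp add: T_D)
    qed
  qed
  then have "J x \<tau> (D_right r) \<le> (\<integral>\<omega>. p + q * W (enn2real (T \<omega>)) \<omega> \<partial>completion (P x))"
    unfolding J_def using x r
    by (intro integral_mono_AE reward_integrable \<tau> D integral_affine_stopped(1)[OF T T_le]) auto
  also have "\<dots> = p + q * x" using x r by (intro integral_affine_stopped(2)[OF T T_le]) auto
  finally show ?thesis .
qed

text \<open>When play ends, the position is \<open>l\<close> with reward \<open>f l\<close>, or
  \<open>r\<close> with reward \<open>g r\<close>. The line through these two points therefore gives
  the reward in every case, and optional stopping evaluates it at \<open>x\<close>.\<close>

lemma J_interval:
  assumes l: "0 \<le> l" "l < x" and r: "x < r" "r \<le> 1"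
  shows "J x (D_left l) (D_right r) = (f l * (r - x) + g r * (x - l)) / (r - l)"
proof -
  define q where "q = (g r - f l) / (r - l)"
  define p where "p = f l - q * l"
  have pl: "p + q * l = f l" by (simp add: p_def)
  have ql: "q * (r - l) = g r - f l" using l r by (simp add: q_def)
  from this have pr: "p + q * r = g r" unfolding p_def by (simp add: algebra_simps)
  have S: "D_left l \<in> stopping_times M P G" "D_right r \<in> stopping_times M P G"
    using l r by (auto intro!: hitting_time_right_stopping hitting_time_left_stopping)
  define T where "T \<omega> = min (D_left l \<omega>) (D_right r \<omega>)" for \<omega>
  have T: "ess_stopping x T"
    unfolding T_def by (intro ess_stopping_min stopping_times_ess_stopping S)
  have T_le: "T \<omega> \<le> exit_time W \<omega>" if "\<omega> \<in> space M" for \<omega>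
    using D_right_le_exit[of r \<omega>] l r that by (auto simp: T_def intro: min.coboundedI2)
  have "AE \<omega> in completion (P x). R (D_left l) (D_right r) \<omega> = p + q * W (enn2real (T \<omega>)) \<omega>"
    using AE_completion[OF start[of x]] AE_completion[OF exit_time_finite[of x]] AE_space
  proof eventually_elim
    case (elim \<omega>)
    then have \<omega>: "\<omega> \<in> space M" and Dr: "D_right r \<omega> = first_exit 0 r (\<lambda>t. W t \<omega>)"
      and Dl: "D_left l \<omega> = first_exit l 1 (\<lambda>t. W t \<omega>)"
      using l r by (auto simp: hitting_time_right_eq hitting_time_left_eq)
    have W0: "W 0 \<omega> \<in> {0<..<1}" "W 0 \<omega> \<in> {0<..<r}" "W 0 \<omega> \<in> {l<..<1}" using elim l r by auto
    have le_exit: "D_right r \<omega> \<le> exit_time W \<omega>" "D_left l \<omega> \<le> exit_time W \<omega>"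
      unfolding Dr Dl exit_time_eq_first_exit using l r by (auto intro!: first_exit_antimono)
    have ext: "extend \<phi> (killed W t \<omega>) = \<phi> (W (enn2real t) \<omega>)"
      if "t \<le> exit_time W \<omega>" "\<phi> 0 = 0" "\<phi> 1 = 0" for \<phi> t
      using \<omega> W0 elim(2) that by (intro extend_killed_stopped) auto
    have at: "W (enn2real (D_right r \<omega>)) \<omega> \<in> {0, r}" "W (enn2real (D_left l \<omega>)) \<omega> \<in> {l, 1}"
      using stopped_at_endpoint[OF \<omega> W0(2)] stopped_at_endpoint[OF \<omega> W0(3)] elim(2) le_exit
      by (auto simp: Dr Dl)
    consider "D_left l \<omega> < D_right r \<omega>" | "D_right r \<omega> < D_left l \<omega>" | "D_right r \<omega> = D_left l \<omega>"
      by (rule linorder_cases) auto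
    then show ?case
    proof cases
      case 1
      \<comment> \<open>The exit from \<open>(l, 1)\<close> is at \<open>l\<close> or
        \<open>1\<close>, and \<open>1\<close> is excluded because the path is still inside
        \<open>(0, r)\<close>.\<close>
      then have "W (enn2real (D_left l \<omega>)) \<omega> = l"
        using at(2) stopped_before(2)[OF \<omega>, of "D_left l \<omega>" 0 r] r by (auto simp: Dr)
      moreover have "T \<omega> = D_left l \<omega>" using 1 unfolding T_def by (intro min_absorb1 less_imp_le)
      ultimately show ?thesis using 1 ext[OF le_exit(2), of f] boundary pl by (simp add: reward_def)
    next
      case 2
      then have "W (enn2real (D_right r \<omega>)) \<omega> = r"
        using at(1) stopped_before(2)[OF \<omega>, of "D_right r \<omega>" l 1] l by (auto simp: Dl)
      moreover have "T \<omega> = D_right r \<omega>" using 2 unfolding T_def by (intro min_absorb2 less_imp_le)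
      moreover have "\<not> D_left l \<omega> < D_right r \<omega>" using 2 by (rule less_not_sym)
      ultimately show ?thesis using 2 ext[OF le_exit(1), of g] boundary pr by (simp add: reward_def)
    next
      case 3
      let ?y = "W (enn2real (D_right r \<omega>)) \<omega>"
      \<comment> \<open>A tie puts the position in both \<open>{0, r}\<close> and
        \<open>{l, 1}\<close>, which with \<open>l < r\<close> forces an endpoint of
        \<open>[0, 1]\<close>. There \<open>h\<close> and the line both vanish.\<close>
      have "?y = l \<and> l = 0 \<or> ?y = r \<and> r = 1" using at 3 l r by auto
      then have "h ?y = p + q * ?y" using pl pr boundary by auto
      with 3 show ?thesis using ext[OF le_exit(1), of h] boundary by (simp add: reward_def T_def)
    qed
  qed
  then have "J x (D_left l) (D_right r) = (\<integral>\<omega>. p + q * W (enn2real (T \<omega>)) \<omega> \<partial>completion (P x))"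
    unfolding J_def using l r S
      borel_measurable_integrable[OF integral_affine_stopped(1)[OF T T_le, of p q]]
    by (intro integral_cong_AE reward_measurable stopping_times_measurable) auto
  also have "\<dots> = p + q * x" using l r by (intro integral_affine_stopped(2)[OF T T_le]) auto
  also have "\<dots> = (f l * (r - x) + g r * (x - l)) / (r - l)"
  proof -
    have "(p + q * x) * (r - l) = f l * (r - l) + (q * (r - l)) * (x - l)"
      by (simp add: p_def algebra_simps)
    also have "\<dots> = f l * (r - x) + g r * (x - l)" unfolding ql by (simp add: algebra_simps)
    finally show ?thesis using l r by (simp add: eq_divide_eq)
  qed
  finally show ?thesis .
qed

text \<open>The line through the origin with slope \<open>g r / r\<close> agrees with
  \<open>g\<close> at both possible stopped positions \<open>0\<close> and \<open>r\<close>. The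
  start \<open>x = 0\<close> is treated apart because optional stopping is available only inside
  \<open>(0, 1)\<close>.\<close>

lemma hitting_mean_right:
  assumes x: "0 \<le> x" "x < r" and r: "r \<le> 1"
  shows "hitting_mean P W g {r..1} x = g r * x / r"
proof (cases "x = 0")
  case True
  have "AE \<omega> in completion (P x). extend g (killed W (D_right r \<omega>) \<omega>) = 0"
    using AE_completion[OF start[of x]]
    by eventually_elim (simp add: True exit_time_zero killed_def extend_def)
  then have "hitting_mean P W g {r..1} x = (\<integral>\<omega>. 0 \<partial>completion (P x))"
    unfolding hitting_mean_def using x r
    by (intro integral_cong_AE extend_killed_measurable cont_g stopping_times_measurable hitting_time_right_stopping) auto
  then show ?thesis using True by simp
next
  case False
  then have x0: "0 < x" using x by simp
  have D: "D_right r \<in> stopping_times M P G" using x r by (intro hitting_time_right_stopping) auto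
  have D_le: "D_right r \<omega> \<le> exit_time W \<omega>" if "\<omega> \<in> space M" for \<omega>
    using x r that by (intro D_right_le_exit) auto
  note aff = integral_affine_stopped[OF stopping_times_ess_stopping[OF D] D_le, of x 0 "g r / r"]
  have "AE \<omega> in completion (P x). extend g (killed W (D_right r \<omega>) \<omega>) = 0 + g r / r * W (enn2real (D_right r \<omega>)) \<omega>"
    using AE_completion[OF start[of x]] AE_completion[OF exit_time_finite[of x]] AE_space
  proof eventually_elim
    case (elim \<omega>)
    then have \<omega>: "\<omega> \<in> space M" and Dr: "D_right r \<omega> = first_exit 0 r (\<lambda>t. W t \<omega>)"
      using x r by (auto simp: hitting_time_right_eq)
    have W0: "W 0 \<omega> \<in> {0<..<1}" "W 0 \<omega> \<in> {0<..<r}" using elim x0 x r by auto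
    have fin: "D_right r \<omega> < \<top>" using D_le[OF \<omega>] elim(2) by auto
    then have "W (enn2real (D_right r \<omega>)) \<omega> \<in> {0, r}"
      using stopped_at_endpoint[OF \<omega> W0(2)] by (simp add: Dr)
    then show ?case
      using extend_killed_stopped[OF \<omega> W0(1) fin D_le[OF \<omega>], of g] boundary x by auto
  qed
  then have "hitting_mean P W g {r..1} x = (\<integral>\<omega>. 0 + g r / r * W (enn2real (D_right r \<omega>)) \<omega> \<partial>completion (P x))"
    unfolding hitting_mean_def using x x0 r D borel_measurable_integrable[OF aff(1)]
    by (intro integral_cong_AE extend_killed_measurable cont_g stopping_times_measurable) auto
  also have "\<dots> = 0 + g r / r * x" using x0 x r by (intro aff(2)) auto
  finally show ?thesis by simp
qed

end

section \<open>Best responses\<close>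

text \<open>The slope is the negated infimum of difference quotients of the convex function
  \<open>-f\<close>, which is finite at interior points.\<close>

lemma concave_on_supergradient:
  fixes f :: "real \<Rightarrow> real"
  assumes "concave_on I f" "x \<in> interior I"
  obtains q where "\<And>y. y \<in> I \<Longrightarrow> f y \<le> f x + q * (y - x)"
proof
  fix y assume "y \<in> I"
  from convex_le_Inf_differential[OF assms(1)[unfolded concave_on_def] assms(2) this]
  show "f y \<le> f x + (- Inf ((\<lambda>t. (- f x - - f t) / (x - t)) ` ({x<..} \<inter> I))) * (y - x)" by simp
qed

context stopping_game
begin

context
  fixes l r c p q :: real
  assumes l: "0 \<le> l" "l < r" and r: "r \<le> 1"
  defines "c \<equiv> (f l - hitting_mean P W g {r..1} l) / (r - l)"
  defines "p \<equiv> c * r" and "q \<equiv> g r / r - c"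
begin

text \<open>\<open>y \<mapsto> p + q y\<close> is the chord through \<open>(l, f l)\<close> and \<open>(r, g r)\<close>.\<close>

lemma chord_r: "p + q * r = g r"
  using l by (simp add: p_def q_def algebra_simps)

lemma chord_l: "p + q * l = f l"
proof -
  have "p + q * l = c * (r - l) + g r * l / r" by (simp add: p_def q_def algebra_simps)
  also have "c * (r - l) = f l - g r * l / r"
    using l r by (simp add: c_def hitting_mean_right)
  finally show ?thesis by simp
qed

lemma chord_interpolate: "(p + q * x) * (r - l) = f l * (r - x) + g r * (x - l)"
  unfolding chord_l[symmetric] chord_r[symmetric] by (simp add: algebra_simps)

text \<open>The chord equals \<open>g r * x / r + c * (r - x)\<close>, so clearing the positive
  denominator is all that is needed.\<close>

lemma utility_le_iff:
  assumes "0 \<le> x" "x < r"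
  shows "(f x - hitting_mean P W g {r..1} x) / (r - x) \<le> c \<longleftrightarrow> f x \<le> p + q * x"
  using assms r by (simp add: hitting_mean_right pos_divide_le_eq p_def q_def algebra_simps)

lemma J_chord: "l < x \<Longrightarrow> x < r \<Longrightarrow> J x (D_left l) (D_right r) = p + q * x"
  using l r chord_interpolate[of x] by (simp add: J_interval divide_eq_eq)

text \<open>
  Wherever play starts in \<open>(0, r)\<close>, an affine function above all rewards touches the claimed value:
  the chord on \<open>[l, r)\<close>, and to the left of \<open>l\<close> a supporting line of \<open>f\<close>.
\<close>

lemma J_le_J_D_left:
  assumes chord: "\<And>y. 0 \<le> y \<Longrightarrow> y < r \<Longrightarrow> f y \<le> p + q * y"
    and concave: "concave_on {0..l} f" and \<tau>: "\<tau> \<in> stopping_times M P G" and x: "x \<in> {0..1}"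
  shows "J x \<tau> (D_right r) \<le> J x (D_left l) (D_right r)"
proof -
  have D: "D_left l \<in> stopping_times M P G" "D_right r \<in> stopping_times M P G"
    using l r by (auto intro!: hitting_time_right_stopping hitting_time_left_stopping)
  \<comment> \<open>The utility is silent at \<open>y = r\<close>; there the chord has value
    \<open>g r\<close>, which dominates \<open>f r\<close>.\<close>
  have chord': "f y \<le> p + q * y" if "y \<in> {0..r}" for y
    using chord[of y] chord_r f_le_g[of r] that l r by (cases "y = r") auto
  consider "x = 0 \<or> x = 1" | "r \<le> x" "x < 1" | "l < x" "x < r" | "0 < x" "x = l" | "0 < x" "x < l"
    using x by fastforce
  then show ?thesis
  proof cases
    case 1
    then show ?thesis using D \<tau> by (simp add: J_boundary)
  next
    case 2
    then show ?thesis using l J_right_le[OF \<tau>, of r x] J_right[of r x l] by simp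
  next
    case 3
    then show ?thesis using l r J_le_affine[OF \<tau>, of x r p q] chord' chord_r by (simp add: J_chord)
  next
    case 4
    then show ?thesis using l r J_le_affine[OF \<tau>, of x r p q] chord' chord_r chord_l
      by (simp add: J_left)
  next
    case 5
    then have "x \<in> interior {0..l}" by simp
    with concave obtain q' where q': "\<And>y. y \<in> {0..l} \<Longrightarrow> f y \<le> f x + q' * (y - x)"
      by (rule concave_on_supergradient) auto
    have "f l - f x \<le> q' * (l - x)" using q'[of l] l by simp
    \<comment> \<open>The chord meets \<open>f\<close> at \<open>l\<close> and lies above it at
      \<open>x\<close>, so it is no steeper than the secant of \<open>f\<close>, which in turn is no
      steeper than the supporting line at \<open>x\<close>.\<close>
    moreover have "q * (l - x) \<le> f l - f x"
      using chord[of x] 5 l chord_l by (simp add: algebra_simps)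
    ultimately have "q * (l - x) \<le> q' * (l - x)" by linarith
    then have qq: "q \<le> q'" using 5 by simp
    \<comment> \<open>At \<open>l\<close> the supporting line is above \<open>f l\<close>, hence
      above the chord, and it is at least as steep. This carries the domination of \<open>f\<close>
      and of \<open>g r\<close> over to it.\<close>
    have above: "p + q * y \<le> f x + q' * (y - x)" if "l \<le> y" for y
    proof -
      have "p + q * y = f l + q * (y - l)" using chord_l by (simp add: algebra_simps)
      also have "\<dots> \<le> (f x + q' * (l - x)) + q' * (y - l)"
        using q'[of l] l that qq by (intro add_mono mult_right_mono) auto
      finally show ?thesis by (simp add: algebra_simps)
    qed
    have "J x \<tau> (D_right r) \<le> (f x - q' * x) + q' * x"
    proof (rule J_le_affine[OF \<tau>])
      show "f y \<le> (f x - q' * x) + q' * y" if "y \<in> {0..r}" for y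
        using q'[of y] above[of y] chord'[OF that] that by (cases "y \<le> l") (auto simp: algebra_simps)
      show "g r \<le> (f x - q' * x) + q' * r"
        using above[of r] l chord_r by (simp add: algebra_simps)
    qed (use 5 l r in auto)
    then show ?thesis using 5 l r by (simp add: J_left)
  qed
qed

text \<open>To test a point \<open>x\<close> it suffices to deviate to \<open>D_left x\<close>, starting from \<open>max x l\<close>.\<close>

lemma le_chord:
  assumes J: "\<And>x \<tau>. x \<in> {0..1} \<Longrightarrow> \<tau> \<in> stopping_times M P G \<Longrightarrow>
      J x \<tau> (D_right r) \<le> J x (D_left l) (D_right r)"
    and x: "0 \<le> x" "x < r"
  shows "f x \<le> p + q * x"
proof -
  have D: "D_left x \<in> stopping_times M P G" using x r by (intro hitting_time_left_stopping) auto
  consider "x = l" | "l < x" | "x < l" by linarith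
  then show ?thesis
  proof cases
    case 1
    then show ?thesis using chord_l by simp
  next
    case 2
    then show ?thesis using J[OF _ D, of x] x l r by (simp add: J_left J_chord)
  next
    case 3
    \<comment> \<open>From \<open>l\<close> the deviation earns the value at \<open>l\<close> of the
      chord from \<open>(x, f x)\<close> to \<open>(r, g r)\<close>, while \<open>D_left l\<close>
      stops at once for \<open>f l\<close>.\<close>
    then have "(f x * (r - l) + g r * (l - x)) / (r - x) \<le> f l"
      using J[OF _ D, of l] x l r by (simp add: J_left J_interval)
    then have "f x * (r - l) + g r * (l - x) \<le> f l * (r - x)"
      using x by (simp add: pos_divide_le_eq)
    then have "f x * (r - l) \<le> (p + q * x) * (r - l)"
      unfolding chord_interpolate by (simp add: algebra_simps)
    then show ?thesis using l by simp
  qed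
qed

text \<open>Both sides say that \<open>f\<close> lies below the chord on \<open>[0, r)\<close>.
  Since \<open>D_left l\<close> is itself admissible, bounding every payoff by its own makes the
  supremum an attained maximum.\<close>

lemma best_response_iff:
  assumes "concave_on {0..l} f"
  shows "(\<forall>x\<in>{0..<r}. (f x - hitting_mean P W g {r..1} x) / (r - x) \<le> c) \<longleftrightarrow>
    (\<forall>x\<in>{0..1}. (SUP \<tau>\<in>stopping_times M P G. J x \<tau> (D_right r)) = J x (D_left l) (D_right r))"
    (is "?U \<longleftrightarrow> ?V")
proof -
  have D: "D_left l \<in> stopping_times M P G" "D_right r \<in> stopping_times M P G"
    using l r by (auto intro!: hitting_time_right_stopping hitting_time_left_stopping)
  show ?thesis
  proof
    assume ?U
    then have "f y \<le> p + q * y" if "0 \<le> y" "y < r" for y using utility_le_iff that by auto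
    then show ?V using J_le_J_D_left[OF _ assms] D by (intro ballI cSup_eq_maximum) auto
  next
    assume V: ?V
    have "J x \<tau> (D_right r) \<le> J x (D_left l) (D_right r)"
      if "x \<in> {0..1}" "\<tau> \<in> stopping_times M P G" for x \<tau>
      using cSUP_upper[OF that(2) J_bdd_above[OF D(2), of x]] V that(1) by simp
    then have "f x \<le> p + q * x" if "0 \<le> x" "x < r" for x using le_chord that by blast
    then show ?U using utility_le_iff by simp
  qed
qed

end

end

section \<open>Reflecting the Brownian family\<close>

lemma (in brownian_family) stopping_times_reflect:
  "stopping_times M (\<lambda>x. P (1 - x)) G = stopping_times M P G"
proof -
  define S where "S = {\<mu> :: real measure. prob_space \<mu> \<and> sets \<mu> = sets borel}"
  \<comment> \<open>Reflecting the kernel amounts to reflecting the initial law. As reflection is an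
    involution, this inclusion used for \<open>P\<close> and for its reflection shows that both have
    the same mixed laws, hence the same universal completion.\<close>
  have sub: "(\<lambda>\<mu>. \<mu> \<bind> (\<lambda>x. K (1 - x))) ` S \<subseteq> (\<lambda>\<mu>. \<mu> \<bind> K) ` S"
    if K: "K \<in> borel \<rightarrow>\<^sub>M prob_algebra M" for K :: "real \<Rightarrow> 'w measure"
  proof (rule image_subsetI)
    fix \<mu> assume \<mu>: "\<mu> \<in> S"
    then interpret \<mu>: prob_space \<mu> by (simp add: S_def)
    have m: "(\<lambda>x. 1 - x) \<in> \<mu> \<rightarrow>\<^sub>M borel"
      using \<mu> by (simp add: S_def measurable_cong_sets[of \<mu> borel])
    have "distr \<mu> borel (\<lambda>x. 1 - x) \<in> S" using \<mu>.prob_space_distr[OF m] by (simp add: S_def)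
    moreover have "distr \<mu> borel (\<lambda>x. 1 - x) \<bind> K = \<mu> \<bind> (\<lambda>x. K (1 - x))"
      by (rule bind_distr[OF m measurable_prob_algebraD[OF K] \<mu>.not_empty])
    ultimately show "\<mu> \<bind> (\<lambda>x. K (1 - x)) \<in> (\<lambda>\<mu>. \<mu> \<bind> K) ` S" by (metis imageI)
  qed
  have "(\<lambda>x. P (1 - x)) \<in> borel \<rightarrow>\<^sub>M prob_algebra M"
    by (rule measurable_compose[OF _ kernel]) simp
  from sub[OF this] sub[OF kernel]
  have eq: "(\<lambda>\<mu>. \<mu> \<bind> (\<lambda>x. P (1 - x))) ` S = (\<lambda>\<mu>. \<mu> \<bind> P) ` S" by simp
  have uc: "universal_completion M Q G t = sigma (space M)
      (\<Inter>\<nu>\<in>(\<lambda>\<mu>. \<mu> \<bind> Q) ` S. sigma_sets (space M) (sets (G t) \<union> null_sets (completion \<nu>)))" for Q t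
    by (simp add: universal_completion_def S_def image_image)
  have "universal_completion M (\<lambda>x. P (1 - x)) G = universal_completion M P G"
    unfolding fun_eq_iff uc eq by blast
  then show ?thesis by (simp add: stopping_times_def)
qed

lemma (in prob_space) indep_set_mono: "indep_set A B \<Longrightarrow> B' \<subseteq> B \<Longrightarrow> indep_set A B'"
  unfolding indep_sets2_eq by blast

text \<open>Increments change sign only: the centred normal law is symmetric, and a preimage of
  \<open>B\<close> becomes one of \<open>-B\<close>. The filtration stays the same.\<close>

lemma (in brownian_family) reflect:
  "brownian_family M G (\<lambda>x. P (1 - x)) (\<lambda>t \<omega>. 1 - W t \<omega>)"
proof
  show "(\<lambda>x. P (1 - x)) \<in> borel \<rightarrow>\<^sub>M prob_algebra M"
    by (rule measurable_compose[OF _ kernel]) simp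
  show "AE \<omega> in P (1 - x). 1 - W 0 \<omega> = x" for x
    using start[of "1 - x"] by eventually_elim simp
  fix s t :: real and x assume st: "0 \<le> s" "s < t"
  have diff: "(\<lambda>\<omega>. 1 - W t \<omega> - (1 - W s \<omega>)) = (\<lambda>\<omega>. 0 + -1 * (W t \<omega> - W s \<omega>))" by auto
  show "distributed (P (1 - x)) lborel (\<lambda>\<omega>. 1 - W t \<omega> - (1 - W s \<omega>)) (normal_density 0 (sqrt (t - s)))"
    using prob_space.normal_density_affine[OF prob_space_P normal_increments[OF st], of "-1" "1 - x" 0] st
    unfolding diff by simp
  have "{(\<lambda>\<omega>. 1 - W t \<omega> - (1 - W s \<omega>)) -` B \<inter> space M | B. B \<in> sets borel}
    \<subseteq> {(\<lambda>\<omega>. W t \<omega> - W s \<omega>) -` B \<inter> space M | B. B \<in> sets borel}"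
  proof clarify
    fix B :: "real set" assume "B \<in> sets borel"
    then have "uminus -` B \<in> sets borel" by (rule measurable_sets_borel[rotated]) simp
    moreover have "(\<lambda>\<omega>. 1 - W t \<omega> - (1 - W s \<omega>)) -` B \<inter> space M
        = (\<lambda>\<omega>. W t \<omega> - W s \<omega>) -` (uminus -` B) \<inter> space M" by auto
    ultimately show "\<exists>B'. (\<lambda>\<omega>. 1 - W t \<omega> - (1 - W s \<omega>)) -` B \<inter> space M
        = (\<lambda>\<omega>. W t \<omega> - W s \<omega>) -` B' \<inter> space M \<and> B' \<in> sets borel" by blast
  qed
  with indep_increments[OF st] show "prob_space.indep_set (P (1 - x)) (sets (G (ennreal s)))
      {(\<lambda>\<omega>. 1 - W t \<omega> - (1 - W s \<omega>)) -` B \<inter> space M | B. B \<in> sets borel}"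
    by (rule prob_space.indep_set_mono[OF prob_space_P])
qed (use sets_G adapted continuous_paths in \<open>auto intro!: continuous_intros\<close>)

theorem theorem4p5:
  fixes M :: "'w measure" and G :: "ennreal \<Rightarrow> 'w measure"
    and P :: "real \<Rightarrow> 'w measure" and W :: "real \<Rightarrow> 'w \<Rightarrow> real"
    and f g h :: "nat \<Rightarrow> real \<Rightarrow> real" and a b :: real
  assumes BM: "brownian_family M G P W"
    and cont: "\<forall>i\<in>{1, 2}. continuous_on {0..1} (f i) \<and> continuous_on {0..1} (g i)
                 \<and> continuous_on {0..1} (h i)"
    and order: "\<forall>i\<in>{1, 2}. \<forall>x\<in>{0..1}. f i x \<le> h i x \<and> h i x \<le> g i x"
    and boundary: "\<forall>i\<in>{1, 2}. \<forall>x\<in>{0, 1}. f i x = 0 \<and> g i x = 0 \<and> h i x = 0"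
    and a: "0 < a" "a < 1" and b: "0 < b" "b < 1"
    and f1: "concave_on {0..a} (f 1)" "convex_on {a..1} (f 1)"
    and f2: "convex_on {0..b} (f 2)" "concave_on {b..1} (f 2)"
    and strict: "b \<le> a \<longrightarrow> (\<forall>i\<in>{1, 2}. \<forall>x\<in>{b..a}. f i x < g i x)"
  shows "(\<forall>r\<in>{b..1}. \<forall>l\<in>{0..a}. l < r \<longrightarrow>
            ((\<forall>x\<in>{0..<r}. utility1 P W f g x r \<le> utility1 P W f g l r) \<longleftrightarrow>
             (\<forall>x\<in>{0..1}.
                (SUP \<tau>\<in>stopping_times M P G. game_payoff P W f g h 1 x \<tau> (hitting_time W {r..1}))
                = game_payoff P W f g h 1 x (hitting_time W {0..l}) (hitting_time W {r..1})))) \<and>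
         (\<forall>l\<in>{0..a}. \<forall>r\<in>{b..1}. l < r \<longrightarrow>
            ((\<forall>y\<in>{l<..1}. utility2 P W f g l y \<le> utility2 P W f g l r) \<longleftrightarrow>
             (\<forall>x\<in>{0..1}.
                (SUP \<tau>\<in>stopping_times M P G. game_payoff P W f g h 2 x (hitting_time W {0..l}) \<tau>)
                = game_payoff P W f g h 2 x (hitting_time W {0..l}) (hitting_time W {r..1}))))"
proof (intro conjI ballI impI)
  fix r l assume rl: "r \<in> {b..1}" "l \<in> {0..a}" "l < r"
  interpret one: stopping_game M G P W "f 1" "g 1" "h 1"
    using BM cont order boundary by (intro stopping_game.intro stopping_game_axioms.intro) auto
  have "concave_on {0..l} (f 1)"
    using f1(1) rl unfolding concave_on_def by (auto intro: convex_on_subset)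
  moreover have "one.J x \<tau> \<sigma> = game_payoff P W f g h 1 x \<tau> \<sigma>" for x \<tau> \<sigma>
    unfolding one.J_def game_payoff_1 ..
  moreover have "(\<forall>x\<in>{0..<r}. utility1 P W f g x r \<le> utility1 P W f g l r) \<longleftrightarrow>
      (\<forall>x\<in>{0..<r}. (f 1 x - hitting_mean P W (g 1) {r..1} x) / (r - x)
        \<le> (f 1 l - hitting_mean P W (g 1) {r..1} l) / (r - l))"
    using rl by (auto simp: utility1_def)
  ultimately show "(\<forall>x\<in>{0..<r}. utility1 P W f g x r \<le> utility1 P W f g l r) \<longleftrightarrow>
     (\<forall>x\<in>{0..1}.
        (SUP \<tau>\<in>stopping_times M P G. game_payoff P W f g h 1 x \<tau> (hitting_time W {r..1}))
        = game_payoff P W f g h 1 x (hitting_time W {0..l}) (hitting_time W {r..1}))"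
    using one.best_response_iff[of l r] rl by simp
next
  fix l r assume rl: "l \<in> {0..a}" "r \<in> {b..1}" "l < r"
  \<comment> \<open>Under reflection the second player's set \<open>[r, 1]\<close> becomes
    \<open>[0, 1 - r]\<close> and the opponent's \<open>[0, l]\<close> becomes
    \<open>[1 - l, 1]\<close>, so the one-player result applies with thresholds \<open>1 - r\<close>
    and \<open>1 - l\<close>.\<close>
  define P' where "P' = (\<lambda>x. P (1 - x))"
  define W' where "W' = (\<lambda>t \<omega>. 1 - W t \<omega>)"
  define refl where "refl \<phi> = (\<lambda>x. \<phi> (1 - x) :: real)" for \<phi> :: "real \<Rightarrow> real"
  have cont_refl: "continuous_on {0..1} (refl \<phi>)" if "continuous_on {0..1} \<phi>" for \<phi>
    unfolding refl_def by (rule continuous_on_compose2[OF that]) (auto intro!: continuous_intros)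
  interpret two: stopping_game M G P' W' "refl (f 2)" "refl (g 2)" "refl (h 2)"
    using brownian_family.reflect[OF BM] cont order boundary
    by (intro stopping_game.intro stopping_game_axioms.intro cont_refl)
      (auto simp: P'_def W'_def refl_def)
  have concave: "concave_on {0..1 - r} (refl (f 2))"
  proof -
    have "convex_on {b..1} (\<lambda>x. - f 2 x)" using f2(2) by (simp add: concave_on_def)
    then have "convex_on {r..1} (\<lambda>x. - f 2 x)" using rl by (auto intro: convex_on_subset)
    then show ?thesis
      unfolding concave_on_def
    proof (intro convex_onI)
      fix t x y :: real assume t: "0 < t" "t < 1" and xy: "x \<in> {0..1 - r}" "y \<in> {0..1 - r}"
      assume c: "convex_on {r..1} (\<lambda>x. - f 2 x)"
      have "1 - ((1 - t) * x + t * y) = (1 - t) * (1 - x) + t * (1 - y)" by (simp add: algebra_simps)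
      with convex_onD[OF c, of t "1 - x" "1 - y"] t xy
      show "- refl (f 2) ((1 - t) *\<^sub>R x + t *\<^sub>R y) \<le> (1 - t) * - refl (f 2) x + t * - refl (f 2) y"
        by (simp add: refl_def)
    qed simp
  qed
  have hit: "hitting_time W' {1 - l..1} = hitting_time W {0..l}" "hitting_time W' {0..1 - r} = hitting_time W {r..1}"
    by (auto simp: W'_def hitting_time_reflect fun_eq_iff)
  have ext: "extend (refl \<phi>) (killed W' t \<omega>) = extend \<phi> (killed W t \<omega>)" for \<phi> t \<omega>
    by (simp add: W'_def refl_def killed_reflect extend_reflect)
  have J: "two.J x \<tau> \<sigma> = game_payoff P W f g h 2 (1 - x) \<sigma> \<tau>" for x \<tau> \<sigma>
    unfolding two.J_def game_payoff_2 reward_def ext by (simp add: P'_def)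
  have mean: "hitting_mean P' W' (refl (g 2)) {1 - l..1} x = hitting_mean P W (g 2) {0..l} (1 - x)" for x
    unfolding hitting_mean_def ext hit by (simp add: P'_def)
  have ST: "stopping_times M P' G = stopping_times M P G"
    unfolding P'_def by (rule brownian_family.stopping_times_reflect[OF BM])
  \<comment> \<open>Returns from reflected to original coordinates, both for the tested points of
    the utility and for the starting points.\<close>
  have reindex: "(\<forall>y\<in>(\<lambda>x. 1 - x) ` A. Q y) \<longleftrightarrow> (\<forall>x\<in>A. Q (1 - x))" for A :: "real set" and Q
    by blast
  have image: "(\<lambda>x. 1 - x) ` {0..<1 - l} = {l<..1}" by simp
  define c where "c = (f 2 r - hitting_mean P W (g 2) {0..l} r) / (r - l)"
  have "(\<forall>y\<in>{l<..1}. utility2 P W f g l y \<le> utility2 P W f g l r) \<longleftrightarrow>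
      (\<forall>y\<in>{l<..1}. (f 2 y - hitting_mean P W (g 2) {0..l} y) / (y - l) \<le> c)"
    using rl by (auto simp: utility2_def c_def)
  also have "\<dots> \<longleftrightarrow> (\<forall>x\<in>{0..<1 - l}. (f 2 (1 - x) - hitting_mean P W (g 2) {0..l} (1 - x)) / (1 - x - l) \<le> c)"
    unfolding image[symmetric] by (simp only: reindex)
  also have "\<dots> \<longleftrightarrow> (\<forall>x\<in>{0..1}.
        (SUP \<tau>\<in>stopping_times M P G. game_payoff P W f g h 2 (1 - x) (hitting_time W {0..l}) \<tau>)
        = game_payoff P W f g h 2 (1 - x) (hitting_time W {0..l}) (hitting_time W {r..1}))"
  proof -
    have refl: "refl \<phi> x = \<phi> (1 - x)" for \<phi> x by (simp add: refl_def)
    have arith: "1 - l - (1 - r) = r - l" "1 - (1 - r) = r" "1 - l - x = 1 - x - l" for x by simp_all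
    show ?thesis
      using two.best_response_iff[of "1 - r" "1 - l", OF _ _ _ concave] rl
      unfolding J mean hit ST refl arith c_def by simp
  qed
  also have "\<dots> \<longleftrightarrow> (\<forall>x\<in>(\<lambda>x. 1 - x) ` {0..1}.
        (SUP \<tau>\<in>stopping_times M P G. game_payoff P W f g h 2 x (hitting_time W {0..l}) \<tau>)
        = game_payoff P W f g h 2 x (hitting_time W {0..l}) (hitting_time W {r..1}))"
    by (simp only: reindex)
  also have "(\<lambda>x. 1 - x) ` {0..1} = {0..1::real}" by simp
  finally show "(\<forall>y\<in>{l<..1}. utility2 P W f g l y \<le> utility2 P W f g l r) \<longleftrightarrow>
     (\<forall>x\<in>{0..1}.
        (SUP \<tau>\<in>stopping_times M P G. game_payoff P W f g h 2 x (hitting_time W {0..l}) \<tau>)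
        = game_payoff P W f g h 2 x (hitting_time W {0..l}) (hitting_time W {r..1}))" .
qed

end
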